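(* The space $(X_{\mathcal S};\langle\cdot;\cdot\rangle)$, after completion, is a reproducing kernel Hilbert space of functions on $[0,\pi]$, where $x\in X_{\mathcal S}$ is identified with the function $\varphi\mapsto x(\varphi)$ on $[0,\pi]$, and its reproducing kernel is $$K(\varphi,\psi)=2-\frac{\pi}{2}\,\sin|\varphi-\psi| ,\qquad \varphi,\psi\in[0,\pi].$$ That is, each evaluation functional $x\mapsto x(\varphi)$ is bounded on $X_{\mathcal S}$, the resulting linear map from the completion to functions on $[0,\pi]$ is injective, and the image (with the transported inner product) is a reproducing kernel Hilbert space with kernel $K$.
   Context: $\mathcal S$ is the family of all non-empty, compact, convex, centrally symmetric ($V=-V$) subsets of $\mathbb R^2$, with Minkowski addition and multiplication $\lambda V=\{\lambda v: v\in V\}$ by scalars $\lambda\ge 0$. Sets with empty interior are allowed. $X_{\mathcal S}$ is the real vector space $(\mathcal S\times\mathcal S)/\diamond$, where $(U,V)\diamond(P,Q)\iff U+Q=V+P$, with operations $[U,V]+[P,Q]=[U+P,V+Q]$, $\lambda[U,V]=[\lambda U,\lambda V]$ for $\lambda\ge0$, and $(-1)[U,V]=[V,U]$. For $U\in\mathcal S$, $m(U)$ is the two-dimensional Lebesgue measure and $o(U)$ is the perimeter, i.e. the coefficient in Steiner's formula $m(U+\lambda B)=m(U)+\lambda o(U)+\lambda^2 m(B)$, $\lambda\ge 0$, with $B$ the closed unit disc (so a segment of length $\ell$ has perimeter $2\ell$). On $X_{\mathcal S}$ put $o([U,V])=o(U)-o(V)$ and consider the inner product $$\langle[U,V];[P,Q]\rangle=\frac{1}{4\pi^2}\Big(2\,o([U,V])\,o([P,Q])-2\pi\big(m(U+P)+m(V+Q)-m(U+Q)-m(V+P)\big)\Big),$$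 which is well defined and positive definite. For $\varphi\in[0,\pi]$ let $f_\varphi(a,b)=-a\sin\varphi+b\cos\varphi$ (the norm-one linear functional whose kernel is the line spanned by $(\cos\varphi,\sin\varphi)$), and for $U\in\mathcal S$ let $\overline U(\varphi)=\sup\{f_\varphi(u):u\in U\}$, i.e. half of the width of $U$ with respect to that line. For $x=[U,V]\in X_{\mathcal S}$ put $x(\varphi)=\overline U(\varphi)-\overline V(\varphi)$, which does not depend on the representative. *)

theory Defs
  imports "HOL-Analysis.Analysis"
begin

section \<open>Centrally symmetric convex bodies in the plane\<close>

typedef sym_body =
  "{V :: (real \<times> real) set. V \<noteq> {} \<and> compact V \<and> convex V \<and> V = uminus ` V}"
  morphisms body_set Abs_sym_body
  by (rule exI[of _ "{0}"]) simp

setup_lifting type_definition_sym_body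

text \<open>The sum of bodies is the Minkowski sum of \<^theory>\<open>HOL-Library.Set_Algebras\<close>.\<close>

instantiation sym_body :: comm_monoid_add
begin

lift_definition zero_sym_body :: sym_body is "{0}"
  by simp

lift_definition plus_sym_body :: "sym_body \<Rightarrow> sym_body \<Rightarrow> sym_body" is "\<lambda>U V. U + V"
proof -
  fix U V :: "(real \<times> real) set"
  assume U: "U \<noteq> {} \<and> compact U \<and> convex U \<and> U = uminus ` U"
    and V: "V \<noteq> {} \<and> compact V \<and> convex V \<and> V = uminus ` V"
  have eq: "U + V = {x + y |x y. x \<in> U \<and> y \<in> V}"
    unfolding set_plus_def by blast
  have neg: "- x \<in> U + V" if "x \<in> U + V" for x
  proof -
    obtain a b where ab: "x = a + b" "a \<in> U" "b \<in> V"
      using \<open>x \<in> U + V\<close> by (auto simp: set_plus_def)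
    have "- a \<in> U" "- b \<in> V"
      using U V ab by auto
    then have "- a + - b \<in> U + V"
      by (rule set_plus_intro)
    then show ?thesis
      by (simp add: ab)
  qed
  have "U + V = uminus ` (U + V)"
  proof
    show "U + V \<subseteq> uminus ` (U + V)"
      using neg by (metis image_iff minus_minus subsetI)
    show "uminus ` (U + V) \<subseteq> U + V"
      using neg by blast
  qed
  moreover have "compact (U + V)"
    unfolding eq using U V by (intro compact_sums) auto
  moreover have "convex (U + V)"
    using U V by (intro convex_set_plus) auto
  moreover have "U + V \<noteq> {}"
    using U V set_plus_intro by blast
  ultimately show "U + V \<noteq> {} \<and> compact (U + V) \<and> convex (U + V) \<and> U + V = uminus ` (U + V)"
    by blast
qed

instance
  by standard (transfer, simp add: add_ac)+

end

lift_definition scale_body :: "real \<Rightarrow> sym_body \<Rightarrow> sym_body" is "\<lambda>c V. (*\<^sub>R) c ` V"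
proof -
  fix c :: real and V :: "(real \<times> real) set"
  assume V: "V \<noteq> {} \<and> compact V \<and> convex V \<and> V = uminus ` V"
  have "(*\<^sub>R) c ` V = (*\<^sub>R) c ` uminus ` V"
    using V by simp
  also have "\<dots> = uminus ` (*\<^sub>R) c ` V"
    by (simp add: image_image)
  finally show "(*\<^sub>R) c ` V \<noteq> {} \<and> compact ((*\<^sub>R) c ` V) \<and> convex ((*\<^sub>R) c ` V)
      \<and> (*\<^sub>R) c ` V = uminus ` (*\<^sub>R) c ` V"
    using V compact_scaling convex_scaling by blast
qed

lift_definition unit_disc :: sym_body is "cball 0 1"
proof -
  have "uminus ` cball 0 1 = (cball 0 1 :: (real \<times> real) set)"
  proof
    show "uminus ` cball 0 1 \<subseteq> (cball 0 1 :: (real \<times> real) set)"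
      by (rule image_subsetI) (simp only: mem_cball dist_0_norm norm_minus_cancel)
    show "(cball 0 1 :: (real \<times> real) set) \<subseteq> uminus ` cball 0 1"
    proof
      fix x :: "real \<times> real"
      assume "x \<in> cball 0 1"
      then have "- x \<in> cball 0 1"
        by (simp only: mem_cball dist_0_norm norm_minus_cancel)
      then show "x \<in> uminus ` cball 0 1"
        by (metis imageI minus_minus)
    qed
  qed
  then show "(cball 0 1 :: (real \<times> real) set) \<noteq> {} \<and> compact (cball 0 1 :: (real \<times> real) set)
      \<and> convex (cball 0 1 :: (real \<times> real) set) \<and> (cball 0 1 :: (real \<times> real) set) = uminus ` cball 0 1"
    by simp
qed

lemma body_set_properties:
  "body_set U \<noteq> {}" "compact (body_set U)" "convex (body_set U)"
  using body_set[of U] by blast+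

lemma body_set_uminus: "uminus ` body_set U = body_set U"
  using body_set[of U] by blast

lemma scale_body_add: "scale_body c (U + V) = scale_body c U + scale_body c V"
proof -
  have "(*\<^sub>R) c ` (A + B) = (*\<^sub>R) c ` A + (*\<^sub>R) c ` B" for A B :: "(real \<times> real) set"
  proof
    show "(*\<^sub>R) c ` (A + B) \<subseteq> (*\<^sub>R) c ` A + (*\<^sub>R) c ` B"
    proof (rule image_subsetI)
      fix x assume "x \<in> A + B"
      then obtain a b where "x = a + b" "a \<in> A" "b \<in> B"
        by (rule set_plus_elim)
      then show "c *\<^sub>R x \<in> (*\<^sub>R) c ` A + (*\<^sub>R) c ` B"
        using set_plus_intro[of "c *\<^sub>R a" _ "c *\<^sub>R b"] by (simp only: scaleR_add_right imageI)
    qed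
    show "(*\<^sub>R) c ` A + (*\<^sub>R) c ` B \<subseteq> (*\<^sub>R) c ` (A + B)"
    proof
      fix x assume "x \<in> (*\<^sub>R) c ` A + (*\<^sub>R) c ` B"
      then obtain a b where "x = c *\<^sub>R (a + b)" "a \<in> A" "b \<in> B"
        unfolding set_plus_def by (auto simp: scaleR_add_right simp del: scaleR_Pair)
      then show "x \<in> (*\<^sub>R) c ` (A + B)"
        by blast
    qed
  qed
  then show ?thesis
    by (simp add: body_set_inject[symmetric] scale_body.rep_eq plus_sym_body.rep_eq)
qed

lemma scale_body_scale: "scale_body a (scale_body b U) = scale_body (a * b) U"
  by (simp add: body_set_inject[symmetric] scale_body.rep_eq image_image)

lemma scale_body_one: "scale_body 1 U = U"
  by (simp add: body_set_inject[symmetric] scale_body.rep_eq)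

lemma scale_body_zero: "scale_body 0 U = 0"
  using body_set_properties(1)[of U]
  by (simp add: body_set_inject[symmetric] scale_body.rep_eq zero_sym_body.rep_eq image_constant_conv
      zero_prod_def)

lemma scale_body_minus: "scale_body (- c) U = scale_body c U"
proof -
  have "(*\<^sub>R) (- c) ` body_set U = (*\<^sub>R) c ` uminus ` body_set U"
    by (simp add: image_image)
  then show ?thesis
    by (simp add: body_set_inject[symmetric] scale_body.rep_eq body_set_uminus)
qed

lemma scale_body_distrib:
  assumes "0 \<le> a" "0 \<le> b"
  shows "scale_body (a + b) U = scale_body a U + scale_body b U"
proof -
  let ?U = "body_set U"
  have "a *\<^sub>R x + b *\<^sub>R y \<in> (*\<^sub>R) (a + b) ` ?U" if "x \<in> ?U" "y \<in> ?U" for x y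
  proof (cases "a + b = 0")
    case True
    then have "a = 0" "b = 0"
      using assms by auto
    then have "a *\<^sub>R x + b *\<^sub>R y = (a + b) *\<^sub>R x"
      by simp
    then show ?thesis
      using that by blast
  next
    case False
    then have "(a / (a + b)) *\<^sub>R x + (b / (a + b)) *\<^sub>R y \<in> ?U"
      using assms that
      by (intro convexD[OF body_set_properties(3)]) (auto simp: add_divide_distrib[symmetric])
    moreover have "a *\<^sub>R x + b *\<^sub>R y = (a + b) *\<^sub>R ((a / (a + b)) *\<^sub>R x + (b / (a + b)) *\<^sub>R y)"
      using False by (simp add: scaleR_add_right)
    ultimately show ?thesis
      by blast
  qed
  then have "(*\<^sub>R) a ` ?U + (*\<^sub>R) b ` ?U \<subseteq> (*\<^sub>R) (a + b) ` ?U"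
    by (auto elim!: set_plus_elim simp del: scaleR_Pair)
  moreover have "(*\<^sub>R) (a + b) ` ?U \<subseteq> (*\<^sub>R) a ` ?U + (*\<^sub>R) b ` ?U"
    using set_plus_intro[of "a *\<^sub>R x" "(*\<^sub>R) a ` ?U" "b *\<^sub>R x" "(*\<^sub>R) b ` ?U" for x]
    by (intro image_subsetI) (simp only: scaleR_add_left imageI)
  ultimately show ?thesis
    by (simp add: body_set_inject[symmetric] scale_body.rep_eq plus_sym_body.rep_eq subset_antisym)
qed

lemma minkowski_cancel_subset:
  fixes A B C :: "(real \<times> real) set"
  assumes B: "convex B" "closed B" and C: "compact C" "C \<noteq> {}"
    and sub: "A + C \<subseteq> B + C"
  shows "A \<subseteq> B"
proof
  fix a assume a: "a \<in> A"
  show "a \<in> B"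
  proof (rule ccontr)
    assume "a \<notin> B"
    then obtain v b where v: "v \<bullet> a < b" "\<And>x. x \<in> B \<Longrightarrow> b < v \<bullet> x"
      using separating_hyperplane_closed_point[OF B] by metis
    have "continuous_on C (\<lambda>x. v \<bullet> x)"
      by (intro continuous_intros)
    then obtain c where c: "c \<in> C" "\<And>y. y \<in> C \<Longrightarrow> v \<bullet> c \<le> v \<bullet> y"
      using continuous_attains_inf[OF C] by blast
    have "a + c \<in> B + C"
      using sub a c(1) by blast
    then obtain b' c' where bc: "a + c = b' + c'" "b' \<in> B" "c' \<in> C"
      by (rule set_plus_elim)
    have "v \<bullet> a + v \<bullet> c = v \<bullet> b' + v \<bullet> c'"
      using bc(1) by (metis inner_add_right)
    with v(1) v(2)[OF bc(2)] c(2)[OF bc(3)] show False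
      by linarith
  qed
qed

lemma sym_body_cancel:
  fixes U V W :: sym_body
  assumes "U + W = V + W"
  shows "U = V"
proof -
  have eq: "body_set U + body_set W = body_set V + body_set W"
    using assms by (simp add: plus_sym_body.rep_eq[symmetric])
  have "body_set U = body_set V"
    using minkowski_cancel_subset[of "body_set V" "body_set W" "body_set U"]
      minkowski_cancel_subset[of "body_set U" "body_set W" "body_set V"]
    by (simp add: eq body_set_properties compact_imp_closed subset_antisym)
  then show ?thesis
    by (simp add: body_set_inject)
qed

section \<open>The space of differences of bodies\<close>

definition diamond :: "sym_body \<times> sym_body \<Rightarrow> sym_body \<times> sym_body \<Rightarrow> bool" where
  "diamond x y \<longleftrightarrow> fst x + snd y = snd x + fst y"

lemma equivp_diamond: "equivp diamond"
proof (rule equivpI)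
  show "reflp diamond"
    by (auto simp: reflp_def diamond_def add.commute)
  show "symp diamond"
    by (auto simp: symp_def diamond_def add.commute)
  show "transp diamond"
  proof (rule transpI)
    fix x y z assume xy: "diamond x y" and yz: "diamond y z"
    have "(fst x + snd z) + (fst y + snd y) = (fst x + snd y) + (fst y + snd z)"
      by (simp add: add_ac)
    also have "\<dots> = (snd x + fst y) + (snd y + fst z)"
      using xy yz by (simp add: diamond_def)
    also have "\<dots> = (snd x + fst z) + (fst y + snd y)"
      by (simp add: add_ac)
    finally show "diamond x z"
      unfolding diamond_def by (rule sym_body_cancel)
  qed
qed

quotient_type body_diff = "sym_body \<times> sym_body" / diamond
  by (rule equivp_diamond)

definition body_class :: "sym_body \<Rightarrow> sym_body \<Rightarrow> body_diff" where
  "body_class U V = abs_body_diff (U, V)"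

lemma body_class_eq_iff: "body_class U V = body_class P Q \<longleftrightarrow> U + Q = V + P"
  by (simp add: body_class_def body_diff.abs_eq_iff diamond_def)

lemma body_class_cases:
  obtains U V where "x = body_class U V"
proof (induct x rule: body_diff.abs_induct)
  case (1 p)
  then show ?case
    by (cases p) (simp add: body_class_def)
qed

instantiation body_diff :: ab_group_add
begin

definition zero_body_diff :: body_diff where
  "zero_body_diff = body_class 0 0"

lift_definition plus_body_diff :: "body_diff \<Rightarrow> body_diff \<Rightarrow> body_diff"
  is "\<lambda>(U, V) (P, Q). (U + P, V + Q)"
proof (unfold diamond_def case_prod_beta fst_conv snd_conv)
  fix x x' y y' :: "sym_body \<times> sym_body"
  assume 1: "fst x + snd x' = snd x + fst x'" and 2: "fst y + snd y' = snd y + fst y'"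
  have "fst x + fst y + (snd x' + snd y') = (fst x + snd x') + (fst y + snd y')"
    by (simp add: add_ac)
  also have "\<dots> = (snd x + fst x') + (snd y + fst y')"
    by (simp only: 1 2)
  also have "\<dots> = snd x + snd y + (fst x' + fst y')"
    by (simp add: add_ac)
  finally show "fst x + fst y + (snd x' + snd y') = snd x + snd y + (fst x' + fst y')" .
qed

lift_definition uminus_body_diff :: "body_diff \<Rightarrow> body_diff" is "\<lambda>(U, V). (V, U)"
  by (simp add: diamond_def case_prod_beta)

definition minus_body_diff :: "body_diff \<Rightarrow> body_diff \<Rightarrow> body_diff" where
  "minus_body_diff x y = x + (- y)"

lemma plus_body_class: "body_class U V + body_class P Q = body_class (U + P) (V + Q)"
  by (simp add: body_class_def plus_body_diff.abs_eq)

lemma uminus_body_class: "- body_class U V = body_class V U"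
  by (simp add: body_class_def uminus_body_diff.abs_eq)

instance
proof
  fix x y z :: body_diff
  obtain U V P Q R S where xyz: "x = body_class U V" "y = body_class P Q" "z = body_class R S"
    using body_class_cases by metis
  show "x + y + z = x + (y + z)" "x + y = y + x" "0 + x = x" "- x + x = 0"
    by (simp_all add: xyz zero_body_diff_def plus_body_class uminus_body_class body_class_eq_iff add_ac)
  show "x - y = x + - y"
    by (rule minus_body_diff_def)
qed

end

instantiation body_diff :: real_vector
begin

lift_definition scaleR_body_diff :: "real \<Rightarrow> body_diff \<Rightarrow> body_diff"
  is "\<lambda>c (U, V). if 0 \<le> c then (scale_body c U, scale_body c V)
                 else (scale_body (- c) V, scale_body (- c) U)"
  by (simp add: diamond_def case_prod_beta scale_body_add[symmetric])

lemma scaleR_body_class: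
  "c *\<^sub>R body_class U V =
    (if 0 \<le> c then body_class (scale_body c U) (scale_body c V)
     else body_class (scale_body (- c) V) (scale_body (- c) U))"
  by (simp add: body_class_def scaleR_body_diff.abs_eq)

instance
proof
  fix x y :: body_diff and a b :: real
  obtain U V P Q where xy: "x = body_class U V" "y = body_class P Q"
    using body_class_cases by metis
  note simps = xy plus_body_class scaleR_body_class body_class_eq_iff
  show "a *\<^sub>R (x + y) = a *\<^sub>R x + a *\<^sub>R y"
    by (simp add: simps scale_body_add add_ac)
  show "1 *\<^sub>R x = x"
    by (simp add: simps scale_body_one add_ac)
  show "a *\<^sub>R b *\<^sub>R x = (a * b) *\<^sub>R x"
    by (cases "a = 0"; cases "b = 0")
      (simp_all add: simps scale_body_scale scale_body_minus scale_body_zero zero_le_mult_iff add.commute)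
  show "(a + b) *\<^sub>R x = a *\<^sub>R x + b *\<^sub>R x"
  proof -
    consider "0 \<le> a" "0 \<le> b" | "a < 0" "b < 0"
      | "0 \<le> a" "b < 0" "0 \<le> a + b" | "0 \<le> a" "b < 0" "a + b < 0"
      | "a < 0" "0 \<le> b" "0 \<le> a + b" | "a < 0" "0 \<le> b" "a + b < 0"
      by linarith
    then show ?thesis
    proof cases
      case 1
      then show ?thesis
        by (simp add: simps scale_body_distrib add_ac)
    next
      case 2
      have "scale_body (- a - b) W = scale_body (- a) W + scale_body (- b) W" for W
        using 2 scale_body_distrib[of "- a" "- b" W] by simp
      with 2 show ?thesis
        by (simp add: simps add_ac)
    next
      case 3
      have "scale_body a W = scale_body (a + b) W + scale_body (- b) W" for W
        using 3 scale_body_distrib[of "a + b" "- b" W] by simp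
      with 3 show ?thesis
        by (simp add: simps add_ac)
    next
      case 4
      have "scale_body (- b) W = scale_body (- a - b) W + scale_body a W" for W
        using 4 scale_body_distrib[of "- a - b" a W] by simp
      with 4 show ?thesis
        by (simp add: simps add_ac)
    next
      case 5
      have "scale_body b W = scale_body (a + b) W + scale_body (- a) W" for W
        using 5 scale_body_distrib[of "a + b" "- a" W] by simp
      with 5 show ?thesis
        by (simp add: simps add_ac)
    next
      case 6
      have "scale_body (- a) W = scale_body (- a - b) W + scale_body b W" for W
        using 6 scale_body_distrib[of "- a - b" b W] by simp
      with 6 show ?thesis
        by (simp add: simps add_ac)
    qed
  qed
qed

end

section \<open>Area, perimeter and the inner product\<close>

definition area :: "sym_body \<Rightarrow> real" where
  "area U = measure lebesgue (body_set U)"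

text \<open>The linear coefficient of Steiner's formula.\<close>

definition perimeter :: "sym_body \<Rightarrow> real" where
  "perimeter U = (THE p. \<forall>r\<ge>0. area (U + scale_body r unit_disc)
                           = area U + r * p + r\<^sup>2 * area unit_disc)"

text \<open>The value of the form is the one common to all pairs of representatives.\<close>

definition diff_inner :: "body_diff \<Rightarrow> body_diff \<Rightarrow> real" where
  "diff_inner x y = (THE r. \<forall>U V P Q. x = body_class U V \<longrightarrow> y = body_class P Q \<longrightarrow>
     r = 1 / (4 * pi\<^sup>2) *
         (2 * (perimeter U - perimeter V) * (perimeter P - perimeter Q)
          - 2 * pi * (area (U + P) + area (V + Q) - area (U + Q) - area (V + P))))"

section \<open>Elements of the space as functions\<close>

definition line_functional :: "real \<Rightarrow> real \<times> real \<Rightarrow> real" where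
  "line_functional \<phi> = (\<lambda>(a, b). - a * sin \<phi> + b * cos \<phi>)"

definition half_width :: "sym_body \<Rightarrow> real \<Rightarrow> real" where
  "half_width U \<phi> = (SUP u\<in>body_set U. line_functional \<phi> u)"

lemma half_width_add: "half_width (U + V) \<phi> = half_width U \<phi> + half_width V \<phi>"
proof -
  let ?f = "line_functional \<phi>"
  have add: "?f (u + v) = ?f u + ?f v" for u v
    by (cases u; cases v) (simp add: line_functional_def algebra_simps)
  have cont: "continuous_on S ?f" for S
    unfolding line_functional_def case_prod_beta by (intro continuous_intros)
  have bdd: "bdd_above (?f ` body_set W)" and ne: "body_set W \<noteq> {}" for W
    using body_set_properties(1,2)[of W] compact_continuous_image[OF cont, of "body_set W"]
    by (auto intro: bounded_imp_bdd_above compact_imp_bounded)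
  show ?thesis
    unfolding half_width_def
  proof (rule antisym)
    show "(SUP u\<in>body_set (U + V). ?f u) \<le> (SUP u\<in>body_set U. ?f u) + (SUP v\<in>body_set V. ?f v)"
    proof (rule cSUP_least[OF ne])
      fix w assume "w \<in> body_set (U + V)"
      then obtain u v where "w = u + v" "u \<in> body_set U" "v \<in> body_set V"
        by (auto simp: plus_sym_body.rep_eq set_plus_def)
      then show "?f w \<le> (SUP u\<in>body_set U. ?f u) + (SUP v\<in>body_set V. ?f v)"
        using cSUP_upper[OF _ bdd] by (simp add: add add_mono)
    qed
    have 1: "?f u + ?f v \<le> (SUP u\<in>body_set (U + V). ?f u)"
      if "u \<in> body_set U" "v \<in> body_set V" for u v
      using that cSUP_upper[OF _ bdd, of "u + v" "U + V"]
      by (auto simp: plus_sym_body.rep_eq add)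
    have "(SUP u\<in>body_set U. ?f u) \<le> (SUP u\<in>body_set (U + V). ?f u) - ?f v"
      if "v \<in> body_set V" for v
      by (rule cSUP_least[OF ne]) (use 1 that in \<open>auto simp: algebra_simps\<close>)
    then have "(SUP v\<in>body_set V. ?f v)
        \<le> (SUP u\<in>body_set (U + V). ?f u) - (SUP u\<in>body_set U. ?f u)"
      by (intro cSUP_least[OF ne]) (auto simp: algebra_simps)
    then show "(SUP u\<in>body_set U. ?f u) + (SUP v\<in>body_set V. ?f v)
        \<le> (SUP u\<in>body_set (U + V). ?f u)"
      by simp
  qed
qed

lift_definition diff_eval :: "body_diff \<Rightarrow> real \<Rightarrow> real"
  is "\<lambda>(U, V) \<phi>. half_width U \<phi> - half_width V \<phi>"
proof (unfold case_prod_beta)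
  fix p q :: "sym_body \<times> sym_body"
  assume "diamond p q"
  then have "half_width (fst p + snd q) \<phi> = half_width (snd p + fst q) \<phi>" for \<phi>
    by (simp add: diamond_def)
  then show "(\<lambda>\<phi>. half_width (fst p) \<phi> - half_width (snd p) \<phi>)
      = (\<lambda>\<phi>. half_width (fst q) \<phi> - half_width (snd q) \<phi>)"
    by (simp add: half_width_add fun_eq_iff algebra_simps)
qed

lemma diff_eval_body_class: "diff_eval (body_class U V) \<phi> = half_width U \<phi> - half_width V \<phi>"
  by (simp add: body_class_def diff_eval.abs_eq)

section \<open>Completion by Cauchy sequences\<close>

text \<open>
  The constructions take the inner product \<open>ip\<close> as a parameter, since a type class instance
  for it would have to come with the proof of positive definiteness.
\<close>

definition ip_norm :: "('a \<Rightarrow> 'a \<Rightarrow> real) \<Rightarrow> 'a \<Rightarrow> real" where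
  "ip_norm ip x = sqrt (ip x x)"

definition ip_Cauchy :: "('a::real_vector \<Rightarrow> 'a \<Rightarrow> real) \<Rightarrow> (nat \<Rightarrow> 'a) set" where
  "ip_Cauchy ip = {s. \<forall>e>0. \<exists>N. \<forall>m\<ge>N. \<forall>n\<ge>N. ip_norm ip (s m - s n) < e}"

definition ip_Cauchy_rel :: "('a::real_vector \<Rightarrow> 'a \<Rightarrow> real) \<Rightarrow> ((nat \<Rightarrow> 'a) \<times> (nat \<Rightarrow> 'a)) set" where
  "ip_Cauchy_rel ip = {(s, t). s \<in> ip_Cauchy ip \<and> t \<in> ip_Cauchy ip \<and>
     (\<lambda>n. ip_norm ip (s n - t n)) \<longlonglongrightarrow> 0}"

definition ip_completion :: "('a::real_vector \<Rightarrow> 'a \<Rightarrow> real) \<Rightarrow> (nat \<Rightarrow> 'a) set set" where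
  "ip_completion ip = ip_Cauchy ip // ip_Cauchy_rel ip"

definition completion_embed ::
    "('a::real_vector \<Rightarrow> 'a \<Rightarrow> real) \<Rightarrow> 'a \<Rightarrow> (nat \<Rightarrow> 'a) set" where
  "completion_embed ip x = ip_Cauchy_rel ip `` {\<lambda>n. x}"

definition completion_add ::
    "('a::real_vector \<Rightarrow> 'a \<Rightarrow> real) \<Rightarrow> (nat \<Rightarrow> 'a) set \<Rightarrow> (nat \<Rightarrow> 'a) set \<Rightarrow> (nat \<Rightarrow> 'a) set" where
  "completion_add ip A B = ip_Cauchy_rel ip `` {\<lambda>n. s n + t n |s t. s \<in> A \<and> t \<in> B}"

definition completion_scale ::
    "('a::real_vector \<Rightarrow> 'a \<Rightarrow> real) \<Rightarrow> real \<Rightarrow> (nat \<Rightarrow> 'a) set \<Rightarrow> (nat \<Rightarrow> 'a) set" where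
  "completion_scale ip c A = ip_Cauchy_rel ip `` {\<lambda>n. c *\<^sub>R s n |s. s \<in> A}"

definition completion_inner ::
    "('a \<Rightarrow> 'a \<Rightarrow> real) \<Rightarrow> (nat \<Rightarrow> 'a) set \<Rightarrow> (nat \<Rightarrow> 'a) set \<Rightarrow> real" where
  "completion_inner ip A B = (THE r. \<forall>s\<in>A. \<forall>t\<in>B. (\<lambda>n. ip (s n) (t n)) \<longlonglongrightarrow> r)"

text \<open>The continuous extension of a bounded functional to the completion.\<close>

definition completion_extend :: "('a \<Rightarrow> real) \<Rightarrow> (nat \<Rightarrow> 'a) set \<Rightarrow> real" where
  "completion_extend L A = (THE r. \<forall>s\<in>A. (\<lambda>n. L (s n)) \<longlonglongrightarrow> r)"

section \<open>Reproducing kernel Hilbert spaces\<close>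

text \<open>
  Functions on \<open>T\<close> are represented by the elements of \<^term>\<open>extensional T\<close>, so that
  equality in \<open>H\<close> is equality on \<open>T\<close>.
\<close>

definition function_subspace :: "'t set \<Rightarrow> ('t \<Rightarrow> real) set \<Rightarrow> bool" where
  "function_subspace T H \<longleftrightarrow> H \<subseteq> extensional T \<and> (\<lambda>t\<in>T. 0) \<in> H \<and>
     (\<forall>f\<in>H. \<forall>g\<in>H. (\<lambda>t\<in>T. f t + g t) \<in> H) \<and>
     (\<forall>c. \<forall>f\<in>H. (\<lambda>t\<in>T. c * f t) \<in> H)"

definition function_inner_product ::
    "'t set \<Rightarrow> ('t \<Rightarrow> real) set \<Rightarrow> (('t \<Rightarrow> real) \<Rightarrow> ('t \<Rightarrow> real) \<Rightarrow> real) \<Rightarrow> bool" where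
  "function_inner_product T H ip \<longleftrightarrow>
     (\<forall>f\<in>H. \<forall>g\<in>H. ip f g = ip g f) \<and>
     (\<forall>f\<in>H. \<forall>g\<in>H. \<forall>h\<in>H. ip (\<lambda>t\<in>T. f t + g t) h = ip f h + ip g h) \<and>
     (\<forall>c. \<forall>f\<in>H. \<forall>h\<in>H. ip (\<lambda>t\<in>T. c * f t) h = c * ip f h) \<and>
     (\<forall>f\<in>H. f \<noteq> (\<lambda>t\<in>T. 0) \<longrightarrow> 0 < ip f f)"

definition function_complete ::
    "'t set \<Rightarrow> ('t \<Rightarrow> real) set \<Rightarrow> (('t \<Rightarrow> real) \<Rightarrow> ('t \<Rightarrow> real) \<Rightarrow> real) \<Rightarrow> bool" where
  "function_complete T H ip \<longleftrightarrow>
     (\<forall>F. (\<forall>n. F n \<in> H) \<longrightarrow>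
        (\<forall>e>0. \<exists>N::nat. \<forall>m\<ge>N. \<forall>n\<ge>N. ip_norm ip (\<lambda>t\<in>T. F m t - F n t) < e) \<longrightarrow>
        (\<exists>f\<in>H. (\<lambda>n. ip_norm ip (\<lambda>t\<in>T. F n t - f t)) \<longlonglongrightarrow> 0))"

definition rkhs ::
    "'t set \<Rightarrow> ('t \<Rightarrow> real) set \<Rightarrow> (('t \<Rightarrow> real) \<Rightarrow> ('t \<Rightarrow> real) \<Rightarrow> real) \<Rightarrow> ('t \<Rightarrow> 't \<Rightarrow> real) \<Rightarrow> bool"
where
  "rkhs T H ip K \<longleftrightarrow>
     function_subspace T H \<and> function_inner_product T H ip \<and> function_complete T H ip \<and>
     (\<forall>t\<in>T. \<exists>C. \<forall>f\<in>H. \<bar>f t\<bar> \<le> C * ip_norm ip f) \<and>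
     (\<forall>t\<in>T. (\<lambda>s\<in>T. K s t) \<in> H \<and> (\<forall>f\<in>H. f t = ip f (\<lambda>s\<in>T. K s t)))"

section \<open>The completed space as a space of functions\<close>

abbreviation diff_completion :: "(nat \<Rightarrow> body_diff) set set" where
  "diff_completion \<equiv> ip_completion diff_inner"

definition diff_function :: "(nat \<Rightarrow> body_diff) set \<Rightarrow> real \<Rightarrow> real" where
  "diff_function A = (\<lambda>\<phi>\<in>{0..pi}. completion_extend (\<lambda>x. diff_eval x \<phi>) A)"

definition transported_inner :: "(real \<Rightarrow> real) \<Rightarrow> (real \<Rightarrow> real) \<Rightarrow> real" where
  "transported_inner f g = completion_inner diff_inner
     (inv_into diff_completion diff_function f) (inv_into diff_completion diff_function g)"

end

theory Submission
  imports Defs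
begin

text \<open>
  Write \<open>h\<close> for the half width of a body. Adding a segment of length \<open>2 * r\<close> with direction \<open>\<phi>\<close> to
  \<open>U\<close> increases the area by \<open>4 * r * h \<phi>\<close>. The zonotope whose half width agrees with that of \<open>U\<close> at
  \<open>n\<close> equidistant angles has sides that depend linearly on \<open>h\<close> and converges to \<open>U\<close>, so
  \<open>area (U + P) - area U - area P\<close> is a limit of bilinear expressions in the half widths. This yields
  Steiner's formula and the bilinearity of the inner product. Positivity is an isoperimetric
  inequality, which follows from a discrete Wirtinger inequality. With the disc \<open>D\<close> and the segment
  \<open>S\<close> from \<open>- e\<close> to \<open>e\<close>, where \<open>e = (cos \<phi>, sin \<phi>)\<close>, the element \<open>2 D - (pi / 2) S\<close> represents
  evaluation at \<open>\<phi>\<close>. Injectivity on the completion holds because a Cauchy sequence with pointwise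
  limit \<open>0\<close> is, by the approximation with zonotopes, weakly null and hence null.
\<close>

section \<open>Half widths\<close>

text \<open>\<open>perimeter\<close> and \<open>diff_inner\<close> are definite descriptions, so
  neither has a usable value before Steiner's formula and independence of the representatives are
  proved. Both rest on bilinearity of the mixed area. The area formula for it only shows symmetry;
  the grid sums show linearity, and their limit joins the two.

  The grid sums discretise the quadratic form of \<open>g'' + g\<close>. A function of period
  \<open>pi\<close> that vanishes at 0 satisfies Dirichlet conditions on an interval of length
  \<open>pi\<close>, where the largest eigenvalue of this operator is exactly 0. That is why the
  form has a sign there, and a multiple of the disc, whose half width is 1, can enforce the
  vanishing.

  Pointwise convergence controls mixed areas with segments, hence with zonotopes. Reaching all
  bodies needs approximation in the norm together with boundedness of the mixed area in the
  norm.\<close>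

lemma linear_line_functional: "linear (line_functional \<phi>)"
  by (rule linearI) (auto simp: line_functional_def algebra_simps)

text \<open>A linear image of a compact convex set is a compact interval, and \<open>V = - V\<close>
  centres it at 0. So the supremum is attained and also bounds absolute values.\<close>

lemma line_functional_image:
  "line_functional \<phi> ` body_set U = {- half_width U \<phi>..half_width U \<phi>}"
proof -
  let ?f = "line_functional \<phi>"
  have "compact (?f ` body_set U)" "convex (?f ` body_set U)"
    using body_set_properties(2,3) linear_line_functional
    by (auto intro!: compact_continuous_image linear_continuous_on convex_linear_image
        simp: linear_conv_bounded_linear)
  then obtain a b where ab: "?f ` body_set U = {a..b}"
    using convex_connected connected_compact_interval_1 by metis
  then have le: "a \<le> b"
    using body_set_properties(1)[of U] by fastforce
  then have b: "half_width U \<phi> = b"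
    by (simp add: half_width_def ab)
  have "uminus ` {a..b} = ?f ` uminus ` body_set U"
    by (simp add: ab[symmetric] image_image linear_neg[OF linear_line_functional])
  then have "{- b..- a} = {a..b}"
    by (simp add: body_set_uminus ab)
  then have "a = - b"
    using le by (simp add: Icc_eq_Icc)
  then show ?thesis
    by (simp add: ab b)
qed

lemma line_functional_le_half_width:
  "u \<in> body_set U \<Longrightarrow> \<bar>line_functional \<phi> u\<bar> \<le> half_width U \<phi>"
  using line_functional_image[of \<phi> U] by (fastforce simp: abs_le_iff)

lemma half_width_attained: "\<exists>u\<in>body_set U. line_functional \<phi> u = half_width U \<phi>"
proof -
  obtain u where "u \<in> body_set U"
    using body_set_properties(1) by blast
  then have "half_width U \<phi> \<in> {- half_width U \<phi>..half_width U \<phi>}"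
    using line_functional_le_half_width[of u U \<phi>] by auto
  then show ?thesis
    unfolding line_functional_image[symmetric] by auto
qed

lemma half_width_nonneg: "0 \<le> half_width U \<phi>"
  using half_width_attained[of U \<phi>] line_functional_le_half_width[of _ U \<phi>] by fastforce

lemma half_width_eqI:
  assumes "\<And>u. u \<in> body_set U \<Longrightarrow> line_functional \<phi> u \<le> w"
    and "v \<in> body_set U" "line_functional \<phi> v = w"
  shows "half_width U \<phi> = w"
  using half_width_attained[of U \<phi>] line_functional_le_half_width[OF assms(2), of \<phi>] assms
  by fastforce

lemma half_width_scale: "0 \<le> c \<Longrightarrow> half_width (scale_body c U) \<phi> = c * half_width U \<phi>"
proof -
  assume c: "0 \<le> c"
  obtain u where "u \<in> body_set U" "line_functional \<phi> u = half_width U \<phi>"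
    using half_width_attained by blast
  moreover have "line_functional \<phi> (c *\<^sub>R v) = c * line_functional \<phi> v" for v
    using linear_cmul[OF linear_line_functional] by simp
  ultimately show ?thesis
    using c line_functional_le_half_width[of _ U \<phi>]
    by (intro half_width_eqI[of _ _ _ "c *\<^sub>R u"])
      (auto simp: scale_body.rep_eq abs_le_iff simp del: scaleR_Pair intro!: mult_left_mono)
qed

lemma half_width_zero: "half_width 0 \<phi> = 0"
  using half_width_scale[of 0 U \<phi> for U] by (simp add: scale_body_zero)

lemma half_width_sum: "half_width (\<Sum>i\<in>I. U i) \<phi> = (\<Sum>i\<in>I. half_width (U i) \<phi>)"
  by (induction I rule: infinite_finite_induct) (simp_all add: half_width_zero half_width_add)

text \<open>Turning the direction by \<open>pi\<close> negates the functional, which a symmetric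
  body does not notice. Grid sums thereby become cyclic.\<close>

lemma half_width_plus_pi: "half_width U (\<phi> + pi) = half_width U \<phi>"
proof -
  have "line_functional (\<phi> + pi) = (\<lambda>u. - line_functional \<phi> u)"
    by (auto simp: line_functional_def)
  then have "line_functional (\<phi> + pi) ` body_set U = uminus ` line_functional \<phi> ` body_set U"
    by (simp add: image_image)
  then show ?thesis
    using half_width_nonneg[of U] by (simp add: line_functional_image Icc_eq_Icc)
qed

lemma half_width_unit_disc: "half_width unit_disc \<phi> = 1"
proof (rule half_width_eqI)
  fix u assume "u \<in> body_set unit_disc"
  then have u: "norm u \<le> 1"
    by (simp add: unit_disc.rep_eq)
  have "line_functional \<phi> u = (- sin \<phi>, cos \<phi>) \<bullet> u"
    by (cases u) (simp add: line_functional_def)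
  also have "\<dots> \<le> norm (- sin \<phi>, cos \<phi>) * norm u"
    by (rule norm_cauchy_schwarz)
  finally show "line_functional \<phi> u \<le> 1"
    using u by (simp add: norm_Pair)
next
  show "(- sin \<phi>, cos \<phi>) \<in> body_set unit_disc"
    by (simp add: unit_disc.rep_eq norm_Pair)
  show "line_functional \<phi> (- sin \<phi>, cos \<phi>) = 1"
    by (simp add: line_functional_def flip: power2_eq_square)
qed

text \<open>A maximiser at one angle competes at the other, and its coordinates are bounded by the
  half widths at 0 and \<open>pi / 2\<close>. Expressing the constant by these two values lets a
  body and its zonotopes share it.\<close>

lemma half_width_lipschitz:
  "\<bar>half_width U \<phi> - half_width U \<psi>\<bar> \<le> (half_width U 0 + half_width U (pi / 2)) * \<bar>\<phi> - \<psi>\<bar>"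
proof -
  let ?L = "half_width U 0 + half_width U (pi / 2)"
  have *: "half_width U \<alpha> - half_width U \<beta> \<le> ?L * \<bar>\<alpha> - \<beta>\<bar>" for \<alpha> \<beta>
  proof -
    obtain a b where u: "(a, b) \<in> body_set U" and eq: "line_functional \<alpha> (a, b) = half_width U \<alpha>"
      using half_width_attained[of U \<alpha>] by auto
    have "\<bar>b\<bar> \<le> half_width U 0" "\<bar>a\<bar> \<le> half_width U (pi / 2)"
      using line_functional_le_half_width[OF u, of 0] line_functional_le_half_width[OF u, of "pi/2"]
      by (simp_all add: line_functional_def)
    moreover have "\<bar>sin \<alpha> - sin \<beta>\<bar> \<le> \<bar>\<alpha> - \<beta>\<bar>" "\<bar>cos \<alpha> - cos \<beta>\<bar> \<le> \<bar>\<alpha> - \<beta>\<bar>"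
    proof -
      have s: "\<bar>sin ((\<alpha> - \<beta>) / 2)\<bar> \<le> \<bar>\<alpha> - \<beta>\<bar> / 2"
        using abs_sin_x_le_abs_x[of "(\<alpha> - \<beta>) / 2"] by simp
      have "\<bar>sin \<alpha> - sin \<beta>\<bar> = 2 * (\<bar>sin ((\<alpha> - \<beta>) / 2)\<bar> * \<bar>cos ((\<alpha> + \<beta>) / 2)\<bar>)"
        by (simp add: sin_diff_sin abs_mult)
      also have "\<dots> \<le> 2 * (\<bar>\<alpha> - \<beta>\<bar> / 2 * 1)"
        using s by (intro mult_left_mono mult_mono) auto
      finally show "\<bar>sin \<alpha> - sin \<beta>\<bar> \<le> \<bar>\<alpha> - \<beta>\<bar>" by simp
      have "\<bar>cos \<alpha> - cos \<beta>\<bar> = 2 * (\<bar>sin ((\<alpha> + \<beta>) / 2)\<bar> * \<bar>sin ((\<alpha> - \<beta>) / 2)\<bar>)"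
        using sin_minus[of "(\<alpha> - \<beta>) / 2"]
        by (simp add: cos_diff_cos abs_mult minus_divide_left del: sin_minus)
      also have "\<dots> \<le> 2 * (1 * (\<bar>\<alpha> - \<beta>\<bar> / 2))"
        using s by (intro mult_left_mono mult_mono) auto
      finally show "\<bar>cos \<alpha> - cos \<beta>\<bar> \<le> \<bar>\<alpha> - \<beta>\<bar>" by simp
    qed
    ultimately have "\<bar>b\<bar> * \<bar>cos \<alpha> - cos \<beta>\<bar> + \<bar>a\<bar> * \<bar>sin \<alpha> - sin \<beta>\<bar> \<le> ?L * \<bar>\<alpha> - \<beta>\<bar>"
      unfolding distrib_right by (intro add_mono mult_mono) auto
    moreover have "line_functional \<alpha> (a, b) - line_functional \<beta> (a, b)
        = b * (cos \<alpha> - cos \<beta>) - a * (sin \<alpha> - sin \<beta>)"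
      by (simp add: line_functional_def algebra_simps)
    moreover have "\<dots> \<le> \<bar>b\<bar> * \<bar>cos \<alpha> - cos \<beta>\<bar> + \<bar>a\<bar> * \<bar>sin \<alpha> - sin \<beta>\<bar>"
      using abs_ge_self[of "b * (cos \<alpha> - cos \<beta>)"] abs_ge_minus_self[of "a * (sin \<alpha> - sin \<beta>)"]
      by (simp add: abs_mult)
    ultimately show ?thesis
      using eq line_functional_le_half_width[OF u, of \<beta>] by linarith
  qed
  show ?thesis
    using *[of \<phi> \<psi>] *[of \<psi> \<phi>] by (simp add: abs_minus_commute abs_le_iff)
qed

text \<open>A point outside a body is cut off by a line, and the normal of that line belongs, up to
  sign, to an angle in \<open>[0, pi]\<close>.\<close>

lemma body_subsetI:
  assumes "\<And>\<phi>. \<phi> \<in> {0..pi} \<Longrightarrow> half_width U \<phi> \<le> half_width V \<phi>"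
  shows "body_set U \<subseteq> body_set V"
proof
  fix a assume a: "a \<in> body_set U"
  show "a \<in> body_set V"
  proof (rule ccontr)
    assume "a \<notin> body_set V"
    then obtain v c where v: "v \<bullet> a < c" "\<And>x. x \<in> body_set V \<Longrightarrow> c < v \<bullet> x"
      using separating_hyperplane_closed_point body_set_properties(3)
        compact_imp_closed[OF body_set_properties(2)] by metis
    obtain v1 v2 where v12: "v = (v1, v2)" by (cases v)
    obtain x0 where x0: "x0 \<in> body_set V"
      using body_set_properties(1) by blast
    define r where "r = norm v"
    have r: "0 < r"
      using v(1) v(2)[OF x0] unfolding r_def by auto
    have r2: "v1\<^sup>2 + v2\<^sup>2 = r\<^sup>2"
      by (simp add: r_def v12 norm_Pair)
    \<comment> \<open>The normal direction is determined up to sign, which the symmetry of the bodies absorbs.\<close>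
    obtain \<sigma> where s: "\<sigma> = 1 \<or> \<sigma> = (-1::real)" and s0: "0 \<le> - \<sigma> * v1"
      by (metis linear mult_1 mult_minus_left neg_0_le_iff_le minus_minus)
    have "(\<sigma> * v2 / r)\<^sup>2 + (- \<sigma> * v1 / r)\<^sup>2 = 1"
      using s r r2 by (auto simp: power_divide add_divide_distrib[symmetric] add.commute)
    then obtain \<phi> where \<phi>: "\<phi> \<in> {0..pi}" "\<sigma> * v2 / r = cos \<phi>" "- \<sigma> * v1 / r = sin \<phi>"
      using sincos_total_pi[OF divide_nonneg_pos[OF s0 r]] by auto
    have eq: "line_functional \<phi> x = \<sigma> * (v \<bullet> x) / r" for x
      using r by (cases x) (simp add: line_functional_def v12 \<phi>(2,3)[symmetric] field_simps)
    obtain u where u: "u \<in> body_set V" "line_functional \<phi> u = half_width V \<phi>"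
      using half_width_attained by blast
    \<comment> \<open>With \<open>u\<close> and \<open>- u\<close> both beyond the line,
      \<open>c\<close> is below minus the absolute value of \<open>v \<bullet> u\<close>. That
      absolute value bounds the one of \<open>v \<bullet> a\<close>, which contradicts
      \<open>v \<bullet> a < c\<close>.\<close>
    have mu: "- u \<in> body_set V"
      using u(1) body_set_uminus[of V] by blast
    have "\<bar>line_functional \<phi> a\<bar> \<le> line_functional \<phi> u"
      using line_functional_le_half_width[OF a, of \<phi>] assms[OF \<phi>(1)] u(2) by linarith
    then have "\<bar>v \<bullet> a\<bar> \<le> \<sigma> * (v \<bullet> u)"
      using r s by (auto simp: eq abs_mult divide_le_cancel)
    moreover have "c < v \<bullet> u" "c < - (v \<bullet> u)"
      using v(2)[OF u(1)] v(2)[OF mu] by simp_all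
    ultimately show False
      using v(1) s by auto
  qed
qed

lemma area_mono: "body_set U \<subseteq> body_set V \<Longrightarrow> area U \<le> area V"
  unfolding area_def
  by (intro measure_mono_fmeasurable lmeasurable_compact fmeasurableD body_set_properties)

lemma area_scale: "area (scale_body c U) = c\<^sup>2 * area U"
  using measure_lebesgue_affine[of c "0 :: real \<times> real" "body_set U"]
  by (simp add: area_def scale_body.rep_eq power2_eq_square)

lemma area_zero: "area 0 = 0"
  by (simp add: area_def zero_sym_body.rep_eq)

lemma area_unit_disc: "area unit_disc = pi"
  using content_cball[of 1 "0 :: real \<times> real"] by (simp add: area_def unit_disc.rep_eq unit_ball_vol_2)

section \<open>Adding a segment\<close>

lemma emeasure_lborel_slices_fst:
  fixes A :: "(real \<times> real) set"
  assumes "A \<in> sets borel"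
  shows "emeasure lborel A = (\<integral>\<^sup>+x. emeasure lborel {y. (x, y) \<in> A} \<partial>lborel)"
  using lborel.emeasure_pair_measure_alt[of A "lborel :: real measure"] assms
  unfolding lborel_prod by (simp add: vimage_def)

lemma emeasure_lborel_slices_snd:
  fixes A :: "(real \<times> real) set"
  assumes "A \<in> sets borel"
  shows "emeasure lborel A = (\<integral>\<^sup>+y. emeasure lborel {x. (x, y) \<in> A} \<partial>lborel)"
  using lborel_pair.emeasure_pair_measure_alt2[of A] assms
  unfolding lborel_prod by (simp add: vimage_def)

lemma measure_shear_image:
  fixes A :: "(real \<times> real) set"
  assumes A: "compact A"
  shows "measure lborel ((\<lambda>(x, y). (x, y - k * x)) ` A) = measure lborel A"
proof -
  let ?T = "\<lambda>(x, y). (x, y - k * x) :: real \<times> real"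
  have TA: "compact (?T ` A)"
    unfolding case_prod_beta by (intro compact_continuous_image A continuous_intros)
  have "{y. (x, y) \<in> ?T ` A} = (+) (- k * x) ` {y. (x, y) \<in> A}" for x
    by (force simp: image_iff)
  moreover have "emeasure lborel ((+) c ` S) = emeasure lborel S" if "compact S" for c and S :: "real set"
  proof -
    have "emeasure lborel S = emeasure (distr lborel borel ((+) (- c))) S"
      by (simp add: lborel_distr_plus)
    also have "\<dots> = emeasure lborel ((+) (- c) -` S)"
      using that by (subst emeasure_distr) (auto simp: borel_compact)
    also have "(+) (- c) -` S = (+) c ` S"
      by (force simp: image_iff)
    finally show ?thesis ..
  qed
  moreover have "compact {y. (x, y) \<in> A}" for x
  proof -
    have "{y. (x, y) \<in> A} = snd ` (A \<inter> {x} \<times> UNIV)"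
      by force
    then show ?thesis
      using A by (auto intro!: compact_continuous_image continuous_intros compact_Int_closed closed_Times)
  qed
  ultimately have "emeasure lborel {y. (x, y) \<in> ?T ` A} = emeasure lborel {y. (x, y) \<in> A}" for x
    by metis
  then have "emeasure lborel (?T ` A) = emeasure lborel A"
    using A TA by (simp add: emeasure_lborel_slices_fst borel_compact)
  then show ?thesis
    by (simp add: measure_def)
qed

lemma measure_swap_image:
  fixes A :: "(real \<times> real) set"
  assumes A: "compact A"
  shows "measure lborel (prod.swap ` A) = measure lborel A"
proof -
  have "compact (prod.swap ` A)"
    using A continuous_on_swap by (rule compact_continuous_image[rotated])
  moreover have "{x. (x, y) \<in> prod.swap ` A} = {x. (y, x) \<in> A}" for y
    by force
  ultimately have "emeasure lborel (prod.swap ` A) = emeasure lborel A"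
    using A emeasure_lborel_slices_snd[of "prod.swap ` A"] emeasure_lborel_slices_fst[of A]
    by (simp add: borel_compact)
  then show ?thesis
    by (simp add: measure_def)
qed

text \<open>By convexity a nonempty horizontal slice is an interval, and the segment lengthens it by
  \<open>2 * a\<close>; integration over the heights \<open>{lo..hi}\<close> gives the
  increase.\<close>

lemma measure_plus_horizontal_segment:
  fixes A :: "(real \<times> real) set"
  assumes A: "compact A" "convex A" and a: "0 \<le> a"
    and snd: "snd ` A = {lo..hi}" "lo \<le> hi"
  shows "measure lborel (A + {-a..a} \<times> {0}) = measure lborel A + 2 * a * (hi - lo)"
proof -
  let ?A' = "A + {-a..a} \<times> {0 :: real}"
  have "compact {x + y |x y. x \<in> A \<and> y \<in> {-a..a} \<times> {0 :: real}}"
    by (rule compact_sums[OF A(1)]) (intro compact_Times; simp)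
  moreover have "?A' = {x + y |x y. x \<in> A \<and> y \<in> {-a..a} \<times> {0}}"
    unfolding set_plus_def by blast
  ultimately have A': "compact ?A'"
    by (simp only:)
  have slice: "emeasure lborel {x. (x, y) \<in> ?A'}
      = emeasure lborel {x. (x, y) \<in> A} + ennreal (2 * a) * indicator {lo..hi} y" for y
  proof (cases "y \<in> {lo..hi}")
    case True
    have eq: "{x. (x, y) \<in> A} = fst ` (A \<inter> UNIV \<times> {y})"
      by force
    have "compact {x. (x, y) \<in> A}" "convex {x. (x, y) \<in> A}"
      unfolding eq using A
      by (auto intro!: compact_continuous_image continuous_intros compact_Int_closed closed_Times
          convex_linear_image convex_Int convex_Times linear_fst)
    then obtain c d where cd: "{x. (x, y) \<in> A} = {c..d}"
      using convex_connected connected_compact_interval_1 by metis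
    have "{x. (x, y) \<in> A} \<noteq> {}"
      using True unfolding snd(1)[symmetric] by force
    then have le: "c \<le> d"
      by (simp add: cd)
    have "{x. (x, y) \<in> ?A'} = {c - a..d + a}"
    proof (intro equalityI subsetI)
      fix x assume "x \<in> {x. (x, y) \<in> ?A'}"
      then obtain x' t where "x = x' + t" "x' \<in> {x. (x, y) \<in> A}" "- a \<le> t" "t \<le> a"
        by (auto elim!: set_plus_elim)
      then show "x \<in> {c - a..d + a}"
        unfolding cd by auto
    next
      fix x assume x: "x \<in> {c - a..d + a}"
      \<comment> \<open>The point of \<open>{c..d}\<close> nearest to \<open>x\<close>; its distance
        from \<open>x\<close> is at most \<open>a\<close>.\<close>
      define x' where "x' = max c (min d x)"
      have "x' \<in> {x. (x, y) \<in> A}"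
        using le unfolding cd x'_def by auto
      moreover have "x - x' \<in> {-a..a}"
        using x le a by (auto simp: x'_def max_def min_def)
      ultimately have "(x', y) + (x - x', 0) \<in> ?A'"
        by (intro set_plus_intro) auto
      then show "x \<in> {x. (x, y) \<in> ?A'}"
        by simp
    qed
    with True le a show ?thesis
      by (simp add: cd ennreal_plus[symmetric] del: ennreal_plus)
  next
    case False
    then have "{x. (x, y) \<in> A} = {}" "{x. (x, y) \<in> ?A'} = {}"
      unfolding snd(1)[symmetric] by (force elim!: set_plus_elim)+
    with False show ?thesis
      by simp
  qed
  have "emeasure lborel ?A'
      = (\<integral>\<^sup>+y. emeasure lborel {x. (x, y) \<in> A} + ennreal (2 * a) * indicator {lo..hi} y \<partial>lborel)"
    using A' by (simp add: emeasure_lborel_slices_snd borel_compact slice)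
  also have "\<dots> = (\<integral>\<^sup>+y. emeasure lborel {x. (x, y) \<in> A} \<partial>lborel)
      + (\<integral>\<^sup>+y. ennreal (2 * a) * indicator {lo..hi} y \<partial>lborel)"
  proof (rule nn_integral_add)
    have "A \<in> sets (lborel \<Otimes>\<^sub>M lborel)"
      unfolding lborel_prod using A(1) by (simp add: borel_compact)
    from lborel_pair.measurable_emeasure_Pair2[OF this]
    show "(\<lambda>y. emeasure lborel {x. (x, y) \<in> A}) \<in> borel_measurable lborel"
      by (simp add: vimage_def)
  qed auto
  also have "\<dots> = emeasure lborel A + ennreal (2 * a * (hi - lo))"
    using A(1) a snd(2)
    by (simp add: emeasure_lborel_slices_snd[symmetric] borel_compact
        nn_integral_cmult_indicator ennreal_mult'')
  finally have "emeasure lborel ?A' = emeasure lborel A + ennreal (2 * a * (hi - lo))" .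
  then show ?thesis
    using emeasure_lborel_cbox_eq emeasure_compact_finite[OF A(1)] a snd(2)
    by (simp add: measure_def enn2real_plus)
qed

text \<open>The endpoint spans the kernel of \<open>line_functional \<phi>\<close>, so
  \<open>half_width U \<phi>\<close> is half the extent of \<open>U\<close> perpendicular to this
  segment.\<close>

lift_definition seg :: "real \<Rightarrow> sym_body" is
  "\<lambda>\<phi>. closed_segment (- (cos \<phi>, sin \<phi>)) (cos \<phi>, sin \<phi>)"
proof -
  fix \<phi> :: real
  have "uminus ` closed_segment (- (cos \<phi>, sin \<phi>)) (cos \<phi>, sin \<phi>)
      = closed_segment (- (- (cos \<phi>, sin \<phi>))) (- (cos \<phi>, sin \<phi>))"
    by (rule closed_segment_linear_image[symmetric]) (simp add: linear_uminus)
  then show "closed_segment (- (cos \<phi>, sin \<phi>)) (cos \<phi>, sin \<phi>) \<noteq> {} \<and>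
      compact (closed_segment (- (cos \<phi>, sin \<phi>)) (cos \<phi>, sin \<phi>)) \<and>
      convex (closed_segment (- (cos \<phi>, sin \<phi>)) (cos \<phi>, sin \<phi>)) \<and>
      closed_segment (- (cos \<phi>, sin \<phi>)) (cos \<phi>, sin \<phi>)
        = uminus ` closed_segment (- (cos \<phi>, sin \<phi>)) (cos \<phi>, sin \<phi>)"
    by (simp add: closed_segment_commute)
qed

lemma body_set_seg: "body_set (seg \<phi>) = (\<lambda>t. t *\<^sub>R (cos \<phi>, sin \<phi>)) ` {-1..1}"
proof (intro equalityI subsetI)
  fix u assume "u \<in> body_set (seg \<phi>)"
  then obtain t where "0 \<le> t" "t \<le> 1" "u = (1 - t) *\<^sub>R (- (cos \<phi>, sin \<phi>)) + t *\<^sub>R (cos \<phi>, sin \<phi>)"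
    by (auto simp: seg.rep_eq closed_segment_def simp del: uminus_Pair scaleR_Pair)
  then have "u = (2 * t - 1) *\<^sub>R (cos \<phi>, sin \<phi>)" "2 * t - 1 \<in> {-1..1}"
    by (auto simp: algebra_simps)
  then show "u \<in> (\<lambda>t. t *\<^sub>R (cos \<phi>, sin \<phi>)) ` {-1..1}"
    by blast
next
  fix u assume "u \<in> (\<lambda>t. t *\<^sub>R (cos \<phi>, sin \<phi>)) ` {-1..1}"
  then obtain t where t: "-1 \<le> t" "t \<le> 1" "u = t *\<^sub>R (cos \<phi>, sin \<phi>)"
    by auto
  then have "u = (1 - (1 + t) / 2) *\<^sub>R (- (cos \<phi>, sin \<phi>)) + ((1 + t) / 2) *\<^sub>R (cos \<phi>, sin \<phi>)"
    by (simp add: field_simps)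
  then show "u \<in> body_set (seg \<phi>)"
    using t(1,2) unfolding seg.rep_eq closed_segment_def
    by (intro CollectI exI[of _ "(1 + t) / 2"]) auto
qed

lemma half_width_seg: "half_width (seg \<psi>) \<phi> = \<bar>sin (\<phi> - \<psi>)\<bar>"
proof (rule half_width_eqI)
  have eq: "line_functional \<phi> (t *\<^sub>R (cos \<psi>, sin \<psi>)) = t * - sin (\<phi> - \<psi>)" for t
    by (simp add: line_functional_def sin_diff algebra_simps)
  show "line_functional \<phi> u \<le> \<bar>sin (\<phi> - \<psi>)\<bar>" if "u \<in> body_set (seg \<psi>)" for u
  proof -
    obtain t where t: "u = t *\<^sub>R (cos \<psi>, sin \<psi>)" "\<bar>t\<bar> \<le> 1"
      using \<open>u \<in> body_set (seg \<psi>)\<close> unfolding body_set_seg by fastforce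
    have "t * - sin (\<phi> - \<psi>) \<le> \<bar>t\<bar> * \<bar>sin (\<phi> - \<psi>)\<bar>"
      using abs_ge_self[of "t * - sin (\<phi> - \<psi>)"] by (simp add: abs_mult)
    also have "\<dots> \<le> 1 * \<bar>sin (\<phi> - \<psi>)\<bar>"
      using t(2) by (intro mult_right_mono) auto
    finally show ?thesis
      unfolding t(1) eq by simp
  qed
  \<comment> \<open>If the sine vanishes, \<open>sgn\<close> is 0 and the witness is the centre of
    the segment.\<close>
  show "- sgn (sin (\<phi> - \<psi>)) *\<^sub>R (cos \<psi>, sin \<psi>) \<in> body_set (seg \<psi>)"
    unfolding body_set_seg by (intro imageI) (auto simp: sgn_if)
  show "line_functional \<phi> (- sgn (sin (\<phi> - \<psi>)) *\<^sub>R (cos \<psi>, sin \<psi>)) = \<bar>sin (\<phi> - \<psi>)\<bar>"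
    unfolding eq by (simp add: sgn_if)
qed

lemma linear_image_set_plus:
  assumes "linear T"
  shows "T ` (A + B) = T ` A + T ` B"
proof (intro equalityI subsetI)
  fix z assume "z \<in> T ` (A + B)"
  then obtain x y where "x \<in> A" "y \<in> B" "z = T x + T y"
    by (auto simp: linear_add[OF assms] elim!: set_plus_elim)
  then show "z \<in> T ` A + T ` B"
    by (simp add: set_plus_intro)
next
  fix z assume "z \<in> T ` A + T ` B"
  then obtain x y where "x \<in> A" "y \<in> B" "z = T (x + y)"
    by (auto simp: linear_add[OF assms] elim!: set_plus_elim)
  then show "z \<in> T ` (A + B)"
    by (simp add: set_plus_intro)
qed

text \<open>\<open>T\<close> makes the segment horizontal. It may stretch the segment by
  \<open>\<bar>t\<bar>\<close>, since the height of the image of \<open>U\<close> is divided by the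
  same factor; hence shears and the swap can replace rotations.\<close>

lemma area_plus_seg_aux:
  assumes T: "linear T" "\<And>A. compact A \<Longrightarrow> measure lborel (T ` A) = measure lborel A"
    and t: "T (cos \<phi>, sin \<phi>) = (t, 0)" "t \<noteq> 0" and \<sigma>: "\<bar>\<sigma>\<bar> = 1"
    and snd: "\<And>u. t * snd (T u) = \<sigma> * line_functional \<phi> u" and r: "0 \<le> r"
  shows "area (U + scale_body r (seg \<phi>)) = area U + 4 * r * half_width U \<phi>"
proof -
  let ?U = "body_set U" and ?h = "half_width U \<phi>"
  have area: "area V = measure lborel (body_set V)" for V
    using body_set_properties(2)[of V] by (simp add: area_def borel_compact)
  have S: "T ` body_set (scale_body r (seg \<phi>)) = {- (r * \<bar>t\<bar>)..r * \<bar>t\<bar>} \<times> {0}"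
  proof -
    have "T ` body_set (scale_body r (seg \<phi>)) = (\<lambda>s. (s * (r * t), 0)) ` {-1..1}"
      unfolding scale_body.rep_eq body_set_seg image_image linear_cmul[OF T(1)] t(1)
      by (simp add: mult_ac)
    also have "\<dots> = (\<lambda>x. (x, 0)) ` (\<lambda>s. s * (r * t)) ` {-1..1}"
      by (simp add: image_image)
    also have "(\<lambda>s. s * (r * t)) ` {-1..1} = {- (r * \<bar>t\<bar>)..r * \<bar>t\<bar>}"
      using r by (subst mult.commute, subst image_mult_atLeastAtMost_if)
        (auto simp: abs_if mult_le_0_iff zero_le_mult_iff zero_less_mult_iff)
    finally show ?thesis
      by auto
  qed
  have "snd ` T ` ?U = (\<lambda>u. \<sigma> / t * line_functional \<phi> u) ` ?U"
    unfolding image_image using t(2) snd by (intro image_cong) (auto simp: field_simps)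
  also have "\<dots> = (*) (\<sigma> / t) ` {- ?h..?h}"
    by (simp add: line_functional_image[symmetric] image_image)
  also have "\<dots> = {- (?h / \<bar>t\<bar>)..?h / \<bar>t\<bar>}"
    using \<sigma> t(2) half_width_nonneg[of U \<phi>]
    by (subst image_mult_atLeastAtMost_if) (auto simp: abs_if field_simps split: if_splits)
  finally have range: "snd ` T ` ?U = {- (?h / \<bar>t\<bar>)..?h / \<bar>t\<bar>}" .
  have "area (U + scale_body r (seg \<phi>)) = measure lborel (T ` body_set (U + scale_body r (seg \<phi>)))"
    unfolding area by (rule T(2)[OF body_set_properties(2), symmetric])
  also have "\<dots> = measure lborel (T ` ?U + T ` body_set (scale_body r (seg \<phi>)))"
    by (simp only: plus_sym_body.rep_eq linear_image_set_plus[OF T(1)])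
  also have "\<dots> = measure lborel (T ` ?U) + 2 * (r * \<bar>t\<bar>) * (?h / \<bar>t\<bar> - - (?h / \<bar>t\<bar>))"
    unfolding S using r half_width_nonneg[of U \<phi>] body_set_properties[of U] T(1) range
    by (intro measure_plus_horizontal_segment compact_continuous_image linear_continuous_on
        convex_linear_image) (auto simp: linear_conv_bounded_linear)
  also have "\<dots> = area U + 4 * r * ?h"
    using T(2) body_set_properties(2)[of U] t(2) by (simp add: area)
  finally show ?thesis .
qed

lemma area_plus_seg:
  assumes "0 \<le> r"
  shows "area (U + scale_body r (seg \<phi>)) = area U + 4 * r * half_width U \<phi>"
proof (cases "cos \<phi> = 0")
  case False
  let ?T = "\<lambda>(x, y). (x, y - tan \<phi> * x) :: real \<times> real"
  show ?thesis
  proof (rule area_plus_seg_aux[of ?T _ "cos \<phi>" 1])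
    show "linear ?T"
      by (rule linearI) (auto simp: algebra_simps)
    show "compact A \<Longrightarrow> measure lborel (?T ` A) = measure lborel A" for A
      by (rule measure_shear_image)
  qed (use False assms in \<open>auto simp: line_functional_def tan_def field_simps\<close>)
next
  case True
  show ?thesis
  \<comment> \<open>For \<open>cos \<phi> = 0\<close>, \<open>sin \<phi>\<close> times the first
    coordinate is minus the functional, whence the sign \<open>-1\<close>.\<close>
  proof (rule area_plus_seg_aux[of prod.swap _ "sin \<phi>" "-1"])
    show "linear (prod.swap :: real \<times> real \<Rightarrow> _)"
      by (rule linearI) auto
  qed (use True assms measure_swap_image sin_cos_squared_add[of \<phi>] in \<open>auto simp: line_functional_def\<close>)
qed

section \<open>Approximation by zonotopes\<close>

text \<open>Each segment adds a term linear in the current half width. The share of the earlier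
  segments occurs with and without \<open>U\<close> and cancels, so the mixed term only sees
  \<open>U\<close>.\<close>

lemma area_plus_zonotope:
  fixes m :: nat
  assumes "\<And>i. 0 \<le> c i"
  shows "area (U + (\<Sum>i<m. scale_body (c i) (seg (\<theta> i))))
    = area U + area (\<Sum>i<m. scale_body (c i) (seg (\<theta> i))) + 4 * (\<Sum>i<m. c i * half_width U (\<theta> i))"
proof (induction m)
  case 0
  show ?case
    by (simp add: area_zero)
next
  case (Suc m)
  let ?Z = "\<Sum>i<m. scale_body (c i) (seg (\<theta> i))"
  have "area (U + ?Z + scale_body (c m) (seg (\<theta> m)))
      = area (U + ?Z) + 4 * c m * (half_width U (\<theta> m) + half_width ?Z (\<theta> m))"
    using assms by (simp add: area_plus_seg half_width_add)
  moreover have "area (?Z + scale_body (c m) (seg (\<theta> m))) = area ?Z + 4 * c m * half_width ?Z (\<theta> m)"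
    using assms by (simp add: area_plus_seg)
  ultimately show ?case
    using Suc.IH by (simp add: add.assoc algebra_simps)
qed

text \<open>
  If \<open>g\<close> is the half width of a body, then \<open>2 * edge \<delta> g \<phi>\<close> is the length of the side with
  direction \<open>\<phi>\<close> of the circumscribed polygon with sides in the directions \<open>\<phi> - \<delta>\<close>, \<open>\<phi>\<close>, \<open>\<phi> + \<delta>\<close>.
\<close>

definition edge :: "real \<Rightarrow> (real \<Rightarrow> real) \<Rightarrow> real \<Rightarrow> real" where
  "edge \<delta> g \<phi> = (g (\<phi> + \<delta>) + g (\<phi> - \<delta>) - 2 * cos \<delta> * g \<phi>) / (2 * sin \<delta>)"

text \<open>A centrally symmetric polygon is the sum of segments parallel to its sides. For
  \<open>2 \<le> n\<close> this one has at most \<open>2 * n\<close> sides and is circumscribed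
  about \<open>U\<close>.\<close>

definition zonotope :: "nat \<Rightarrow> sym_body \<Rightarrow> sym_body" where
  "zonotope n U =
    (\<Sum>i<n. scale_body (edge (pi / n) (half_width U) (real i * (pi / n))) (seg (real i * (pi / n))))"

text \<open>A discretisation of 2 times the integral of \<open>f * (g + g'')\<close> over
  \<open>[0, pi]\<close>, the classical formula for twice the mixed area: for small
  \<open>\<delta>\<close>, \<open>edge \<delta> g\<close> is about
  \<open>\<delta> / 2 * (g + g'')\<close>.\<close>

definition grid_sum :: "nat \<Rightarrow> (real \<Rightarrow> real) \<Rightarrow> (real \<Rightarrow> real) \<Rightarrow> real" where
  "grid_sum n f g = 4 * (\<Sum>i<n. edge (pi / n) g (real i * (pi / n)) * f (real i * (pi / n)))"

lemma sin_pi_divide_pos: "2 \<le> n \<Longrightarrow> 0 < sin (pi / real n)"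
  by (intro sin_gt_zero) (auto simp: field_simps)

text \<open>\<open>edge\<close> annihilates the functional of a fixed point; testing a maximiser at
  \<open>\<phi>\<close> against the two neighbouring angles gives the sign. The sign matters because
  \<open>scale_body\<close> ignores that of its factor.\<close>

lemma edge_half_width_nonneg:
  assumes "0 < sin \<delta>"
  shows "0 \<le> edge \<delta> (half_width U) \<phi>"
proof -
  obtain u where u: "u \<in> body_set U" "line_functional \<phi> u = half_width U \<phi>"
    using half_width_attained by blast
  have "2 * cos \<delta> * half_width U \<phi> = line_functional (\<phi> + \<delta>) u + line_functional (\<phi> - \<delta>) u"
    unfolding u(2)[symmetric]
    by (cases u) (simp add: line_functional_def sin_add sin_diff cos_add cos_diff algebra_simps)
  also have "\<dots> \<le> half_width U (\<phi> + \<delta>) + half_width U (\<phi> - \<delta>)"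
    using line_functional_le_half_width[OF u(1)] by (intro add_mono) (auto simp: abs_le_iff)
  finally show ?thesis
    using assms by (simp add: edge_def)
qed

section \<open>Periodic difference equations on the grid\<close>

lemma edge_add: "edge \<delta> (\<lambda>x. f x + g x) \<phi> = edge \<delta> f \<phi> + edge \<delta> g \<phi>"
  by (simp add: edge_def add_divide_distrib diff_divide_distrib ring_distribs)

lemma edge_cmult: "edge \<delta> (\<lambda>x. c * f x) \<phi> = c * edge \<delta> f \<phi>"
  by (simp add: edge_def ring_distribs mult_ac)

lemma sum_lessThan_shift_periodic:
  fixes f :: "nat \<Rightarrow> real"
  assumes "\<And>i. f (i + n) = f i"
  shows "(\<Sum>k<n. f (j + k)) = (\<Sum>k<n. f k)"
proof (induction j)
  case (Suc j)
  have "(\<Sum>k<n. f (Suc j + k)) + f j = (\<Sum>k<n. f (j + k)) + f (j + n)"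
    using sum.lessThan_Suc_shift[of "\<lambda>k. f (j + k)" n] by simp
  with Suc show ?case
    by (simp add: assms)
qed simp

text \<open>
  Summation by parts: the sequence \<open>\<bar>sin (k * pi / n)\<bar>\<close> is a fundamental solution of the difference
  operator in the definition of \<open>edge\<close>.
\<close>

lemma sum_edge_sin:
  assumes n: "2 \<le> n" and g: "\<And>x. g (x + pi) = g x"
  shows "(\<Sum>i<n. edge (pi / n) g (real i * (pi / n)) * \<bar>sin (real j * (pi / n) - real i * (pi / n))\<bar>)
    = g (real j * (pi / n))"
proof -
  define \<delta> where "\<delta> = pi / n"
  have n\<delta>: "real n * \<delta> = pi"
    using n by (simp add: \<delta>_def)
  define H where "H = (\<lambda>k::real. g ((real j + k) * \<delta>))"
  \<comment> \<open>A discrete Wronskian of \<open>g\<close> and a homogeneous solution; its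
    increments are the summands up to the factor \<open>2 * sin \<delta>\<close>.\<close>
  define D where "D = (\<lambda>k::real. sin ((k - 1) * \<delta>) * H k - sin (k * \<delta>) * H (k - 1))"
  let ?P = "\<lambda>i. edge \<delta> g (real i * \<delta>) * \<bar>sin (real j * \<delta> - real i * \<delta>)\<bar>"
  have "?P (i + n) = ?P i" for i
  proof -
    have eq: "real (i + n) * \<delta> = real i * \<delta> + pi"
      using n\<delta> by (simp add: distrib_right)
    have "edge \<delta> g (real (i + n) * \<delta>) = edge \<delta> g (real i * \<delta>)"
      using g[of "real i * \<delta>"] g[of "real i * \<delta> + \<delta>"] g[of "real i * \<delta> - \<delta>"]
      unfolding eq edge_def by (simp add: algebra_simps)
    moreover have "real j * \<delta> - real i * \<delta> = real j * \<delta> - real (i + n) * \<delta> + pi"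
      unfolding eq by simp
    then have "\<bar>sin (real j * \<delta> - real i * \<delta>)\<bar> = \<bar>sin (real j * \<delta> - real (i + n) * \<delta>)\<bar>"
      by (simp only: sin_periodic_pi abs_minus_cancel)
    ultimately show ?thesis
      by (simp only:)
  qed
  \<comment> \<open>The cyclic sum is started at \<open>j\<close>: over the next \<open>n\<close>
    angles the sine keeps its sign, so the absolute value disappears.\<close>
  then have "(\<Sum>i<n. ?P i) = (\<Sum>k<n. ?P (j + k))"
    by (rule sum_lessThan_shift_periodic[symmetric])
  also have "\<dots> = (\<Sum>k<n. (D (real (Suc k)) - D (real k)) / (2 * sin \<delta>))"
  proof (rule sum.cong[OF refl])
    fix k assume "k \<in> {..<n}"
    then have "real k * \<delta> \<le> real n * \<delta>"
      by (intro mult_right_mono) (auto simp: \<delta>_def)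
    then have "0 \<le> sin (real k * \<delta>)"
      using n\<delta> by (intro sin_ge_zero) (auto simp: \<delta>_def)
    moreover have "real j * \<delta> - real (j + k) * \<delta> = - (real k * \<delta>)"
      by (simp add: algebra_simps)
    ultimately have "\<bar>sin (real j * \<delta> - real (j + k) * \<delta>)\<bar> = sin (real k * \<delta>)"
      by simp
    moreover have "edge \<delta> g (real (j + k) * \<delta>)
        = (H (real k + 1) + H (real k - 1) - 2 * cos \<delta> * H (real k)) / (2 * sin \<delta>)"
      by (simp add: edge_def H_def algebra_simps)
    moreover have "D (real (Suc k)) - D (real k)
        = sin (real k * \<delta>) * (H (real k + 1) + H (real k - 1))
          - H (real k) * (sin (real k * \<delta> + \<delta>) + sin (real k * \<delta> - \<delta>))"
      by (simp add: D_def algebra_simps)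
    moreover have "sin (real k * \<delta> + \<delta>) + sin (real k * \<delta> - \<delta>) = 2 * cos \<delta> * sin (real k * \<delta>)"
      by (simp add: sin_add sin_diff)
    ultimately show "?P (j + k) = (D (real (Suc k)) - D (real k)) / (2 * sin \<delta>)"
      by (simp only:) (simp add: algebra_simps)
  qed
  also have "\<dots> = (D (real n) - D 0) / (2 * sin \<delta>)"
    using sum_lessThan_telescope[of "\<lambda>k. D (real k)" n]
    by (simp add: sum_divide_distrib[symmetric] del: of_nat_Suc)
  \<comment> \<open>Both ends contribute \<open>sin \<delta>\<close>, from
    \<open>sin ((n - 1) * \<delta>) = sin \<delta>\<close> and
    \<open>sin (- \<delta>) = - sin \<delta>\<close>.\<close>
  also have "D (real n) - D 0 = 2 * sin \<delta> * g (real j * \<delta>)"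
  proof -
    have "H (real n) = H 0"
      using g[of "real j * \<delta>"] by (simp add: H_def distrib_right n\<delta>)
    moreover have "sin ((real n - 1) * \<delta>) = sin \<delta>"
      by (simp add: left_diff_distrib n\<delta> sin_diff)
    ultimately show ?thesis
      using n\<delta> by (simp add: D_def H_def)
  qed
  finally show ?thesis
    using sin_pi_divide_pos[OF n] by (simp add: \<delta>_def)
qed

text \<open>
  Discrete Wirtinger inequality with Dirichlet condition; the proof compares \<open>g\<close> with the positive
  solution \<open>sin (i * pi / n)\<close> of the difference equation (Picone).
\<close>

lemma sum_edge_mult_nonpos:
  assumes n: "2 \<le> n" and g: "\<And>x. g (x + pi) = g x" and g0: "g 0 = 0"
  shows "(\<Sum>i<n. edge (pi / n) g (real i * (pi / n)) * g (real i * (pi / n))) \<le> 0"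
proof -
  define \<delta> where "\<delta> = pi / n"
  define a s where "a = (\<lambda>i::nat. g (real i * \<delta>))" and "s = (\<lambda>i::nat. sin (real i * \<delta>))"
  have n\<delta>: "real n * \<delta> = pi"
    using n by (simp add: \<delta>_def)
  have s_pos: "0 < s i" if "0 < i" "i < n" for i
  proof -
    have "real i * \<delta> < real n * \<delta>"
      using that by (intro mult_strict_right_mono) (auto simp: \<delta>_def)
    then show ?thesis
      using that unfolding s_def n\<delta> by (intro sin_gt_zero) (auto simp: \<delta>_def)
  qed
  define t where "t = (\<lambda>i. a i * (a (Suc i) + a (i - 1)) - 2 * cos \<delta> * (a i)\<^sup>2)"
  have s_step: "s (Suc i) + s (i - 1) = 2 * cos \<delta> * s i" if "0 < i" for i
  proof -
    have "real (Suc i) * \<delta> = real i * \<delta> + \<delta>" "real (i - 1) * \<delta> = real i * \<delta> - \<delta>"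
      using that by (simp_all add: algebra_simps of_nat_diff)
    then show ?thesis
      unfolding s_def by (simp only: sin_add sin_diff) simp
  qed
  \<comment> \<open>The right side is the boundary term of Picone's identity, with equality for
    \<open>m = 1\<close>. For \<open>m = n - 1\<close> it vanishes because
    \<open>a n = s n = 0\<close>.\<close>
  have bound: "(\<Sum>i\<in>{1..m}. t i) \<le> a m * a (Suc m) - (a m)\<^sup>2 * s (Suc m) / s m"
    if "1 \<le> m" "m < n" for m
    using that
  proof (induction m rule: dec_induct)
    case base
    have "s 0 = 0" "a 0 = 0"
      using g0 by (simp_all add: s_def a_def)
    with base s_step[of 1] s_pos[of 1] show ?case
      by (simp add: t_def field_simps)
  next
    case (step m)
    have pos: "0 < s m" "0 < s (Suc m)"
      using step by (auto intro: s_pos)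
    \<comment> \<open>This square is what the induction step loses. The division needs
      \<open>s\<close> positive, so the sum avoids the zeros of \<open>s\<close> at 0 and
      \<open>n\<close>.\<close>
    have "0 \<le> (a m * s (Suc m) - a (Suc m) * s m)\<^sup>2 / (s m * s (Suc m))"
      using pos by simp
    also have "\<dots> = (a m)\<^sup>2 * s (Suc m) / s m + (a (Suc m))\<^sup>2 * s m / s (Suc m) - 2 * a m * a (Suc m)"
      using pos by (simp add: field_simps power2_eq_square)
    finally have "2 * a m * a (Suc m) \<le> (a m)\<^sup>2 * s (Suc m) / s m + (a (Suc m))\<^sup>2 * s m / s (Suc m)"
      by simp
    moreover have "2 * cos \<delta> = (s (Suc (Suc m)) + s m) / s (Suc m)"
      using s_step[of "Suc m"] pos by (simp add: field_simps)
    then have "t (Suc m) = a (Suc m) * (a (Suc (Suc m)) + a m)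
        - (a (Suc m))\<^sup>2 * s (Suc (Suc m)) / s (Suc m) - (a (Suc m))\<^sup>2 * s m / s (Suc m)"
      by (simp add: t_def add_divide_distrib algebra_simps)
    ultimately show ?case
      using step by (simp add: algebra_simps)
  qed
  have "(\<Sum>i<n. edge \<delta> g (real i * \<delta>) * g (real i * \<delta>))
      = (\<Sum>i\<in>{1..n-1}. edge \<delta> g (real i * \<delta>) * g (real i * \<delta>))"
  proof (rule sum.mono_neutral_right)
    show "\<forall>i\<in>{..<n} - {1..n - 1}. edge \<delta> g (real i * \<delta>) * g (real i * \<delta>) = 0"
    proof
      fix i assume "i \<in> {..<n} - {1..n - 1}"
      then have "i = 0" using n by auto
      then show "edge \<delta> g (real i * \<delta>) * g (real i * \<delta>) = 0" using g0 by simp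
    qed
  qed (use n in auto)
  also have "\<dots> = (\<Sum>i\<in>{1..n-1}. t i / (2 * sin \<delta>))"
  proof (rule sum.cong[OF refl])
    fix i assume "i \<in> {1..n - 1}"
    then have eq: "real (Suc i) * \<delta> = real i * \<delta> + \<delta>" "real (i - 1) * \<delta> = real i * \<delta> - \<delta>"
      by (simp_all add: algebra_simps of_nat_diff)
    show "edge \<delta> g (real i * \<delta>) * g (real i * \<delta>) = t i / (2 * sin \<delta>)"
      unfolding edge_def t_def a_def eq by (simp add: power2_eq_square algebra_simps)
  qed
  also have "\<dots> = (\<Sum>i\<in>{1..n-1}. t i) / (2 * sin \<delta>)"
    by (simp add: sum_divide_distrib)
  also have "\<dots> \<le> 0"
  proof -
    have "a n = 0" "s n = 0"
      using g[of 0] g0 n\<delta> by (simp_all add: a_def s_def)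
    then have "(\<Sum>i\<in>{1..n-1}. t i) \<le> 0"
      using bound[of "n - 1"] n by simp
    then show ?thesis
      using sin_pi_divide_pos[OF n] by (simp add: divide_nonpos_pos \<delta>_def)
  qed
  finally show ?thesis
    by (simp add: \<delta>_def)
qed

section \<open>Interpolation by zonotopes and convergence of areas\<close>

lemma half_width_zonotope_grid:
  assumes "2 \<le> n"
  shows "half_width (zonotope n U) (real j * (pi / n)) = half_width U (real j * (pi / n))"
  using sum_edge_sin[OF assms, of "half_width U" j]
    edge_half_width_nonneg[OF sin_pi_divide_pos[OF assms], of U]
  by (simp add: zonotope_def half_width_sum half_width_scale half_width_seg half_width_plus_pi)

text \<open>Zonotope and body agree at a grid point within \<open>pi / n\<close> of
  \<open>\<phi>\<close>, and each moves by at most its Lipschitz bound. The bounds coincide because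
  \<open>n\<close> is even, which makes \<open>pi / 2\<close> a grid point.\<close>

lemma half_width_zonotope_close:
  assumes n: "n = 2 * Suc k" and \<phi>: "\<phi> \<in> {0..pi}"
  shows "\<bar>half_width (zonotope n U) \<phi> - half_width U \<phi>\<bar>
    \<le> 2 * (half_width U 0 + half_width U (pi / 2)) * (pi / n)"
proof -
  have n2: "2 \<le> n" using n by simp
  define \<delta> where "\<delta> = pi / n"
  have \<delta>: "0 < \<delta>" using n2 by (simp add: \<delta>_def)
  let ?L = "half_width U 0 + half_width U (pi / 2)"
  define j where "j = nat \<lfloor>\<phi> / \<delta>\<rfloor>"
  have "0 \<le> \<phi> / \<delta>"
    using \<phi> \<delta> by simp
  then have "real j \<le> \<phi> / \<delta>" "\<phi> / \<delta> \<le> real j + 1"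
    unfolding j_def by linarith+
  then have close: "\<bar>\<phi> - real j * \<delta>\<bar> \<le> \<delta>"
    using \<delta> by (simp add: field_simps)
  have half: "real (Suc k) * (pi / n) = pi / 2"
    by (simp add: n field_simps)
  have L: "half_width (zonotope n U) 0 + half_width (zonotope n U) (pi / 2) = ?L"
    using half_width_zonotope_grid[OF n2, of U 0] half_width_zonotope_grid[OF n2, of U "Suc k"]
    unfolding half by simp
  have "half_width (zonotope n U) (real j * \<delta>) = half_width U (real j * \<delta>)"
    unfolding \<delta>_def by (rule half_width_zonotope_grid[OF n2])
  moreover have "\<bar>half_width (zonotope n U) \<phi> - half_width (zonotope n U) (real j * \<delta>)\<bar>
      \<le> ?L * \<bar>\<phi> - real j * \<delta>\<bar>"
    using half_width_lipschitz[of "zonotope n U"] unfolding L .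
  moreover have "\<bar>half_width U \<phi> - half_width U (real j * \<delta>)\<bar> \<le> ?L * \<bar>\<phi> - real j * \<delta>\<bar>"
    by (rule half_width_lipschitz)
  moreover have "?L * \<bar>\<phi> - real j * \<delta>\<bar> \<le> ?L * \<delta>"
    using close half_width_nonneg[of U] by (intro mult_left_mono) auto
  ultimately show ?thesis
    unfolding \<delta>_def[symmetric] by linarith
qed

text \<open>Two perpendicular segments scaled by \<open>e\<close> form a square of half width at
  least \<open>e\<close> in every direction. So \<open>V\<close> plus this square contains
  \<open>U\<close>, and its area is explicit.\<close>

lemma area_le_of_half_width:
  assumes "\<And>\<phi>. \<phi> \<in> {0..pi} \<Longrightarrow> half_width U \<phi> \<le> half_width V \<phi> + e" and e: "0 \<le> e"
  shows "area U \<le> area V + 4 * e * (half_width V 0 + half_width V (pi / 2)) + 4 * e\<^sup>2"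
proof -
  have "half_width U \<phi> \<le> half_width (V + scale_body e (seg 0) + scale_body e (seg (pi / 2))) \<phi>"
    if "\<phi> \<in> {0..pi}" for \<phi>
  proof -
    have "1 \<le> \<bar>sin \<phi>\<bar> + \<bar>cos \<phi>\<bar>"
    proof -
      have "(sin \<phi>)\<^sup>2 + (cos \<phi>)\<^sup>2 \<le> \<bar>sin \<phi>\<bar> + \<bar>cos \<phi>\<bar>"
        using mult_left_mono[OF abs_sin_le_one[of \<phi>] abs_ge_zero[of "sin \<phi>"]]
          mult_left_mono[OF abs_cos_le_one[of \<phi>] abs_ge_zero[of "cos \<phi>"]]
        by (intro add_mono) (simp_all add: power2_eq_square)
      then show ?thesis by simp
    qed
    then have "e * 1 \<le> e * (\<bar>sin \<phi>\<bar> + \<bar>cos \<phi>\<bar>)"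
      using e by (intro mult_left_mono)
    with assms(1)[OF that] e show ?thesis
      by (simp add: half_width_add half_width_scale half_width_seg sin_diff algebra_simps)
  qed
  then have "area U \<le> area (V + scale_body e (seg 0) + scale_body e (seg (pi / 2)))"
    by (intro area_mono body_subsetI)
  also have "\<dots> = area V + 4 * e * (half_width V 0 + half_width V (pi / 2)) + 4 * e\<^sup>2"
    unfolding area_plus_seg[OF e] half_width_add half_width_scale[OF e] half_width_seg
    by (simp add: power2_eq_square algebra_simps)
  finally show ?thesis .
qed

lemma area_tendsto:
  assumes close: "\<And>k \<phi>. \<phi> \<in> {0..pi} \<Longrightarrow> \<bar>half_width (Z k) \<phi> - half_width U \<phi>\<bar> \<le> e k"
    and e: "e \<longlonglongrightarrow> 0"
  shows "(\<lambda>k::nat. area (Z k)) \<longlonglongrightarrow> area U"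
proof -
  let ?w = "half_width U 0 + half_width U (pi / 2)"
  have e0: "0 \<le> e k" for k
    using close[of 0 k] by auto
  have upper: "area (Z k) \<le> area U + 4 * e k * ?w + 4 * (e k)\<^sup>2" for k
    using close[of _ k] e0 by (intro area_le_of_half_width) (auto simp: abs_le_iff algebra_simps)
  \<comment> \<open>\<open>12 = 4 + 8\<close>: the two widths of \<open>Z k\<close> together exceed
    those of \<open>U\<close> by at most \<open>2 * e k\<close>, which costs another
    \<open>8 * (e k)^2\<close>.\<close>
  have lower: "area U - 4 * e k * ?w - 12 * (e k)\<^sup>2 \<le> area (Z k)" for k
  proof -
    have "area U \<le> area (Z k) + 4 * e k * (half_width (Z k) 0 + half_width (Z k) (pi / 2)) + 4 * (e k)\<^sup>2"
      using close[of _ k] e0 by (intro area_le_of_half_width) (auto simp: abs_le_iff algebra_simps)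
    moreover have "half_width (Z k) 0 + half_width (Z k) (pi / 2) \<le> ?w + 2 * e k"
      using close[of 0 k] close[of "pi / 2" k] by (simp add: abs_le_iff)
    then have "4 * e k * (half_width (Z k) 0 + half_width (Z k) (pi / 2)) \<le> 4 * e k * (?w + 2 * e k)"
      using e0 by (intro mult_left_mono) auto
    ultimately show ?thesis
      by (simp add: algebra_simps power2_eq_square)
  qed
  have "(\<lambda>k. area U + 4 * e k * ?w + 4 * (e k)\<^sup>2) \<longlonglongrightarrow> area U + 4 * 0 * ?w + 4 * 0\<^sup>2"
    "(\<lambda>k. area U - 4 * e k * ?w - 12 * (e k)\<^sup>2) \<longlonglongrightarrow> area U - 4 * 0 * ?w - 12 * 0\<^sup>2"
    by (intro tendsto_intros e)+
  then show ?thesis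
    using tendsto_sandwich[OF always_eventually[OF allI[OF lower]] always_eventually[OF allI[OF upper]]]
    by simp
qed

lemma area_zonotope_tendsto: "(\<lambda>k. area (V + zonotope (2 * Suc k) U)) \<longlonglongrightarrow> area (V + U)"
proof (rule area_tendsto)
  let ?e = "\<lambda>k. 2 * (half_width U 0 + half_width U (pi / 2)) * (pi / real (2 * Suc k))"
  show "\<bar>half_width (V + zonotope (2 * Suc k) U) \<phi> - half_width (V + U) \<phi>\<bar> \<le> ?e k"
    if "\<phi> \<in> {0..pi}" for k \<phi>
    using half_width_zonotope_close[OF refl that, of k U] by (simp add: half_width_add)
  have "(\<lambda>k. (half_width U 0 + half_width U (pi / 2)) * pi * inverse (real (Suc k)))
      \<longlonglongrightarrow> (half_width U 0 + half_width U (pi / 2)) * pi * 0"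
    by (intro tendsto_mult_left LIMSEQ_inverse_real_of_nat)
  moreover have "2 * w * (pi / real (2 * Suc k)) = w * pi * inverse (real (Suc k))" for w k
    by (simp add: inverse_eq_divide of_nat_mult del: of_nat_Suc mult_Suc_right)
  ultimately show "?e \<longlonglongrightarrow> 0"
    by (simp only:) simp
qed

lemma area_plus_zonotope_grid:
  assumes "2 \<le> n"
  shows "area (V + zonotope n U) - area V - area (zonotope n U)
    = grid_sum n (half_width V) (half_width U)"
  using edge_half_width_nonneg[OF sin_pi_divide_pos[OF assms]]
  by (simp add: zonotope_def grid_sum_def area_plus_zonotope)

lemma grid_sum_tendsto:
  "(\<lambda>k. grid_sum (2 * Suc k) (half_width V) (half_width U)) \<longlonglongrightarrow> area (V + U) - area V - area U"
proof -
  have "(\<lambda>k. area (V + zonotope (2 * Suc k) U) - area V - area (0 + zonotope (2 * Suc k) U))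
      \<longlonglongrightarrow> area (V + U) - area V - area (0 + U)"
    by (intro tendsto_intros area_zonotope_tendsto)
  then show ?thesis
    by (simp add: area_plus_zonotope_grid)
qed

section \<open>The mixed area as a bilinear form\<close>

lemma diff_eval_add: "diff_eval (x + y) \<phi> = diff_eval x \<phi> + diff_eval y \<phi>"
proof -
  obtain U V P Q where "x = body_class U V" "y = body_class P Q"
    using body_class_cases by metis
  then show ?thesis
    by (simp add: plus_body_class diff_eval_body_class half_width_add)
qed

lemma diff_eval_scaleR: "diff_eval (c *\<^sub>R x) \<phi> = c * diff_eval x \<phi>"
proof -
  obtain U V where "x = body_class U V"
    using body_class_cases by metis
  then show ?thesis
    by (simp add: scaleR_body_class diff_eval_body_class half_width_scale right_diff_distrib)
qed

lemma diff_eval_minus: "diff_eval (- x) \<phi> = - diff_eval x \<phi>"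
  using diff_eval_scaleR[of "- 1" x \<phi>] by simp

lemma diff_eval_diff: "diff_eval (x - y) \<phi> = diff_eval x \<phi> - diff_eval y \<phi>"
  using diff_eval_add[of x "- y" \<phi>] by (simp add: diff_eval_minus)

lemma diff_eval_plus_pi: "diff_eval x (\<phi> + pi) = diff_eval x \<phi>"
  by (cases x rule: body_class_cases) (simp add: diff_eval_body_class half_width_plus_pi)

lemma grid_sum_add_left: "grid_sum n (\<lambda>x. f x + f' x) g = grid_sum n f g + grid_sum n f' g"
  by (simp add: grid_sum_def distrib_left sum.distrib)

lemma grid_sum_cmult_left: "grid_sum n (\<lambda>x. c * f x) g = c * grid_sum n f g"
  by (simp add: grid_sum_def sum_distrib_left mult_ac)

lemma grid_sum_add_right: "grid_sum n f (\<lambda>x. g x + g' x) = grid_sum n f g + grid_sum n f g'"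
  by (simp add: grid_sum_def edge_add distrib_left distrib_right sum.distrib)

lemma grid_sum_cmult_right: "grid_sum n f (\<lambda>x. c * g x) = c * grid_sum n f g"
  by (simp add: grid_sum_def edge_cmult sum_distrib_left mult_ac)

text \<open>On bodies this is twice the mixed area. As a limit over grids it inherits linearity from
  the grid sums, and \<open>mixed_tendsto\<close> shows that the limit exists. The grids are the
  even ones on which zonotopes were shown to converge.\<close>

definition mixed :: "body_diff \<Rightarrow> body_diff \<Rightarrow> real" where
  "mixed x y = lim (\<lambda>k. grid_sum (2 * Suc k) (diff_eval x) (diff_eval y))"

lemma mixed_tendsto_body_class:
  "(\<lambda>k. grid_sum (2 * Suc k) (diff_eval (body_class U V)) (diff_eval (body_class P Q)))
    \<longlonglongrightarrow> area (U + P) + area (V + Q) - area (U + Q) - area (V + P)"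
proof -
  have eval: "diff_eval (body_class U V) = (\<lambda>\<phi>. half_width U \<phi> + (- 1) * half_width V \<phi>)" for U V
    by (simp add: fun_eq_iff diff_eval_body_class)
  have eq: "grid_sum n (diff_eval (body_class U V)) (diff_eval (body_class P Q))
      = grid_sum n (half_width U) (half_width P) + grid_sum n (half_width V) (half_width Q)
        - grid_sum n (half_width U) (half_width Q) - grid_sum n (half_width V) (half_width P)" for n
    unfolding eval grid_sum_add_left grid_sum_add_right grid_sum_cmult_left grid_sum_cmult_right
    by simp
  have "(\<lambda>k. grid_sum (2 * Suc k) (half_width U) (half_width P)
        + grid_sum (2 * Suc k) (half_width V) (half_width Q)
        - grid_sum (2 * Suc k) (half_width U) (half_width Q)
        - grid_sum (2 * Suc k) (half_width V) (half_width P))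
      \<longlonglongrightarrow> (area (U + P) - area U - area P) + (area (V + Q) - area V - area Q)
        - (area (U + Q) - area U - area Q) - (area (V + P) - area V - area P)"
    by (intro tendsto_intros grid_sum_tendsto)
  then show ?thesis
    unfolding eq by (simp add: algebra_simps)
qed

lemma mixed_body_class:
  "mixed (body_class U V) (body_class P Q) = area (U + P) + area (V + Q) - area (U + Q) - area (V + P)"
  unfolding mixed_def by (rule limI) (rule mixed_tendsto_body_class)

lemma mixed_tendsto:
  "(\<lambda>k. grid_sum (2 * Suc k) (diff_eval x) (diff_eval y)) \<longlonglongrightarrow> mixed x y"
proof -
  obtain U V P Q where "x = body_class U V" "y = body_class P Q"
    using body_class_cases by metis
  then show ?thesis
    using mixed_tendsto_body_class by (simp add: mixed_body_class)
qed

text \<open>Symmetry is read off the area formula, since the grid sums treat their two arguments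
  differently.\<close>

lemma mixed_commute: "mixed x y = mixed y x"
proof -
  obtain U V P Q where "x = body_class U V" "y = body_class P Q"
    using body_class_cases by metis
  then show ?thesis
    by (simp add: mixed_body_class add.commute)
qed

lemma mixed_add_left: "mixed (x + x') y = mixed x y + mixed x' y"
proof (rule LIMSEQ_unique[OF mixed_tendsto])
  have "grid_sum n (diff_eval (x + x')) g = grid_sum n (diff_eval x) g + grid_sum n (diff_eval x') g" for n g
    unfolding grid_sum_add_left[symmetric] diff_eval_add[symmetric] ..
  then show "(\<lambda>k. grid_sum (2 * Suc k) (diff_eval (x + x')) (diff_eval y)) \<longlonglongrightarrow> mixed x y + mixed x' y"
    by (simp only:) (intro tendsto_add mixed_tendsto)
qed

lemma mixed_scaleR_left: "mixed (c *\<^sub>R x) y = c * mixed x y"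
proof (rule LIMSEQ_unique[OF mixed_tendsto])
  have "grid_sum n (diff_eval (c *\<^sub>R x)) g = c * grid_sum n (diff_eval x) g" for n g
    unfolding grid_sum_cmult_left[symmetric] diff_eval_scaleR[symmetric] ..
  then show "(\<lambda>k. grid_sum (2 * Suc k) (diff_eval (c *\<^sub>R x)) (diff_eval y)) \<longlonglongrightarrow> c * mixed x y"
    by (simp only:) (intro tendsto_mult_left mixed_tendsto)
qed

lemma mixed_diff_left: "mixed (x - x') y = mixed x y - mixed x' y"
  using mixed_add_left[of x "- 1 *\<^sub>R x'" y] by (simp add: mixed_scaleR_left[of "- 1", simplified])

lemma mixed_diff_right: "mixed y (x - x') = mixed y x - mixed y x'"
  using mixed_diff_left mixed_commute by metis

lemma mixed_scaleR_right: "mixed y (c *\<^sub>R x) = c * mixed y x"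
  using mixed_scaleR_left mixed_commute by metis

section \<open>Perimeter and inner product as mixed areas\<close>

abbreviation of_body :: "sym_body \<Rightarrow> body_diff" where
  "of_body U \<equiv> body_class U 0"

lemma diff_eval_of_body: "diff_eval (of_body U) \<phi> = half_width U \<phi>"
  by (simp add: diff_eval_body_class half_width_zero)

lemma of_body_scale: "0 \<le> c \<Longrightarrow> of_body (scale_body c U) = c *\<^sub>R of_body U"
  using scale_body_scale[of c 0 0] by (simp add: scaleR_body_class scale_body_zero)

lemma mixed_of_body: "mixed (of_body U) (of_body P) = area (U + P) - area U - area P"
  by (simp add: mixed_body_class area_zero)

lemma mixed_of_body_seg: "mixed x (of_body (seg \<phi>)) = 4 * diff_eval x \<phi>"
proof -
  obtain U V where "x = body_class U V"
    using body_class_cases by metis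
  then show ?thesis
    using area_plus_seg[of 1 U \<phi>] area_plus_seg[of 1 V \<phi>]
    by (simp add: mixed_body_class scale_body_one diff_eval_body_class)
qed

lemma mixed_self_of_body: "mixed (of_body U) (of_body U) = 2 * area U"
  using scale_body_distrib[of 1 1 U] area_scale[of 2 U]
  by (simp add: mixed_of_body scale_body_one)

text \<open>Homogeneity makes the mixed term linear in \<open>r\<close>, which is Steiner's formula;
  its instance \<open>r = 1\<close> determines the coefficient.\<close>

lemma perimeter_eq: "perimeter U = mixed (of_body U) (of_body unit_disc)"
proof -
  have steiner: "area (U + scale_body r unit_disc)
      = area U + r * mixed (of_body U) (of_body unit_disc) + r\<^sup>2 * area unit_disc" if "0 \<le> r" for r
    using mixed_of_body[of U "scale_body r unit_disc"] that
    by (simp add: of_body_scale mixed_scaleR_right area_scale)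
  show ?thesis
    unfolding perimeter_def
  proof (rule the_equality)
    fix p assume "\<forall>r\<ge>0. area (U + scale_body r unit_disc) = area U + r * p + r\<^sup>2 * area unit_disc"
    then have "area (U + scale_body 1 unit_disc) = area U + 1 * p + 1\<^sup>2 * area unit_disc"
      by (metis zero_le_one)
    then show "p = mixed (of_body U) (of_body unit_disc)"
      using steiner[of 1] by simp
  qed (use steiner in blast)
qed

text \<open>Perimeter differences and the area expression are values of \<open>mixed\<close>, which
  depends on the classes alone; so the description in \<open>diff_inner\<close> has a unique
  solution.\<close>

lemma diff_inner_eq:
  "diff_inner x y = 1 / (4 * pi\<^sup>2) *
    (2 * mixed x (of_body unit_disc) * mixed y (of_body unit_disc) - 2 * pi * mixed x y)"
proof -
  have perim: "perimeter U - perimeter V = mixed (body_class U V) (of_body unit_disc)" for U V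
    by (simp add: perimeter_eq mixed_body_class area_zero)
  show ?thesis
    unfolding diff_inner_def
  proof (rule the_equality)
    fix r assume "\<forall>U V P Q. x = body_class U V \<longrightarrow> y = body_class P Q \<longrightarrow>
     r = 1 / (4 * pi\<^sup>2) *
         (2 * (perimeter U - perimeter V) * (perimeter P - perimeter Q)
          - 2 * pi * (area (U + P) + area (V + Q) - area (U + Q) - area (V + P)))"
    moreover obtain U V P Q where "x = body_class U V" "y = body_class P Q"
      using body_class_cases by metis
    ultimately show "r = 1 / (4 * pi\<^sup>2) *
      (2 * mixed x (of_body unit_disc) * mixed y (of_body unit_disc) - 2 * pi * mixed x y)"
      by (simp only: perim mixed_body_class)
  qed (intro allI impI, simp only: perim mixed_body_class)
qed

lemma mixed_self_nonpos:
  assumes "diff_eval x 0 = 0"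
  shows "mixed x x \<le> 0"
proof (rule LIMSEQ_le_const2[OF mixed_tendsto], intro exI allI impI)
  fix k :: nat
  show "grid_sum (2 * Suc k) (diff_eval x) (diff_eval x) \<le> 0"
    unfolding grid_sum_def using sum_edge_mult_nonpos[of "2 * Suc k" "diff_eval x"] assms
    by (simp only: diff_eval_plus_pi) simp
qed

lemma mixed_disc_disc: "mixed (of_body unit_disc) (of_body unit_disc) = 2 * pi"
  by (simp add: mixed_self_of_body area_unit_disc)

text \<open>
  On the hyperplane \<open>mixed x D = 0\<close> the form is negative semidefinite, since adding a multiple of
  the disc \<open>D\<close> to reach \<open>diff_eval x 0 = 0\<close> can only increase its value.
\<close>

lemma mixed_isoperimetric: "2 * pi * mixed x x \<le> (mixed x (of_body unit_disc))\<^sup>2"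
proof -
  let ?D = "of_body unit_disc"
  \<comment> \<open>Projection along the disc, normalised by
    \<open>mixed ?D ?D = 2 * pi\<close>.\<close>
  define y where "y = x - (mixed x ?D / (2 * pi)) *\<^sub>R ?D"
  define z where "z = y - diff_eval y 0 *\<^sub>R ?D"
  have yD: "mixed y ?D = 0"
    by (simp add: y_def mixed_diff_left mixed_scaleR_left mixed_disc_disc)
  have "mixed z z = mixed y y + (diff_eval y 0)\<^sup>2 * (2 * pi)"
    using yD mixed_commute[of ?D y]
    by (simp add: z_def mixed_diff_left mixed_diff_right mixed_scaleR_left mixed_scaleR_right
        mixed_disc_disc power2_eq_square)
  moreover have "mixed z z \<le> 0"
    by (rule mixed_self_nonpos)
      (simp add: z_def diff_eval_diff diff_eval_scaleR diff_eval_of_body half_width_unit_disc)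
  ultimately have "mixed y y \<le> 0"
    by (smt (verit) mult_nonneg_nonneg pi_gt_zero zero_le_power2)
  moreover have "mixed y y = mixed x x - (mixed x ?D)\<^sup>2 / (2 * pi)"
    using mixed_commute[of ?D x]
    by (simp add: y_def mixed_diff_left mixed_diff_right mixed_scaleR_left mixed_scaleR_right
        mixed_disc_disc power2_eq_square)
  ultimately show ?thesis
    by (simp add: field_simps)
qed

lemma diff_inner_commute: "diff_inner x y = diff_inner y x"
  by (simp add: diff_inner_eq mixed_commute[of x y] mult.commute mult.left_commute)

lemma diff_inner_add_left: "diff_inner (x + x') y = diff_inner x y + diff_inner x' y"
  by (simp add: diff_inner_eq mixed_add_left algebra_simps add_divide_distrib diff_divide_distrib)

lemma diff_inner_scaleR_left: "diff_inner (c *\<^sub>R x) y = c * diff_inner x y"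
  by (simp add: diff_inner_eq mixed_scaleR_left algebra_simps diff_divide_distrib)

text \<open>One copy of the squared perimeter dominates \<open>2 * pi * mixed x x\<close>; the other
  copy is left over.\<close>

lemma diff_inner_self_nonneg: "0 \<le> diff_inner x x"
proof -
  have "0 \<le> 2 * mixed x (of_body unit_disc) * mixed x (of_body unit_disc) - 2 * pi * mixed x x"
    using mixed_isoperimetric[of x] zero_le_power2[of "mixed x (of_body unit_disc)"]
    unfolding power2_eq_square by linarith
  then show ?thesis
    unfolding diff_inner_eq by (intro mult_nonneg_nonneg) simp_all
qed

text \<open>With coefficients \<open>a\<close> of the disc and \<open>b\<close> of the segment, the
  perimeter terms in the pairing with \<open>x\<close> cancel if \<open>b = - pi / 4 * a\<close>.
  What remains is \<open>- 2 * b / pi\<close> times the value of \<open>x\<close> at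
  \<open>\<phi>\<close>, so \<open>b = - pi / 2\<close> and \<open>a = 2\<close>.\<close>

definition kernel_point :: "real \<Rightarrow> body_diff" where
  "kernel_point \<phi> = 2 *\<^sub>R of_body unit_disc - (pi / 2) *\<^sub>R of_body (seg \<phi>)"

lemma diff_eval_kernel_point: "diff_eval (kernel_point \<phi>) \<psi> = 2 - pi / 2 * \<bar>sin (\<psi> - \<phi>)\<bar>"
  by (simp add: kernel_point_def diff_eval_diff diff_eval_scaleR diff_eval_of_body
      half_width_unit_disc half_width_seg)

lemma diff_inner_kernel_point: "diff_inner x (kernel_point \<phi>) = diff_eval x \<phi>"
proof -
  have perim: "mixed (kernel_point \<phi>) (of_body unit_disc) = 2 * pi"
    by (simp add: kernel_point_def mixed_diff_left mixed_scaleR_left mixed_disc_disc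
        mixed_commute[of "of_body (seg \<phi>)"] mixed_of_body_seg diff_eval_of_body half_width_unit_disc)
  have mixed: "mixed x (kernel_point \<phi>) = 2 * mixed x (of_body unit_disc) - 2 * pi * diff_eval x \<phi>"
    by (simp add: kernel_point_def mixed_diff_right mixed_scaleR_right mixed_of_body_seg)
  show ?thesis
    unfolding diff_inner_eq perim mixed by (simp add: field_simps power2_eq_square)
qed

section \<open>Completions of spaces with a semi-inner product\<close>

text \<open>Only semidefiniteness is assumed: elements of norm 0 become 0 when Cauchy sequences are
  taken modulo null sequences.\<close>

locale semi_inner =
  fixes ip :: "'a::real_vector \<Rightarrow> 'a \<Rightarrow> real"
  assumes commute: "ip x y = ip y x"
    and add_left: "ip (x + x') y = ip x y + ip x' y"
    and scaleR_left: "ip (c *\<^sub>R x) y = c * ip x y"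
    and nonneg: "0 \<le> ip x x"
begin

abbreviation (input) nrm :: "'a \<Rightarrow> real" where
  "nrm \<equiv> ip_norm ip"

lemma minus_left: "ip (- x) y = - ip x y"
  using scaleR_left[of "- 1" x y] by simp

lemma diff_left: "ip (x - x') y = ip x y - ip x' y"
  using add_left[of x "- x'" y] by (simp add: minus_left)

lemma add_right: "ip y (x + x') = ip y x + ip y x'"
  using add_left commute by metis

lemma diff_right: "ip y (x - x') = ip y x - ip y x'"
  using diff_left commute by metis

lemma scaleR_right: "ip y (c *\<^sub>R x) = c * ip y x"
  using scaleR_left commute by metis

lemma nrm_nonneg: "0 \<le> nrm x"
  by (simp add: ip_norm_def nonneg)

lemma nrm_power2: "(nrm x)\<^sup>2 = ip x x"
  by (simp add: ip_norm_def nonneg)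

lemma nrm_scaleR: "nrm (c *\<^sub>R x) = \<bar>c\<bar> * nrm x"
  by (simp add: ip_norm_def scaleR_left scaleR_right real_sqrt_mult flip: mult.assoc)

lemma nrm_minus_commute: "nrm (x - y) = nrm (y - x)"
  using nrm_scaleR[of "- 1" "x - y"] by simp

lemma nrm_zero: "nrm 0 = 0"
  using nrm_scaleR[of 0 0] by simp

lemma cauchy_schwarz: "\<bar>ip x y\<bar> \<le> nrm x * nrm y"
proof -
  have "(ip x y)\<^sup>2 \<le> ip x x * ip y y"
  proof (cases "ip y y = 0")
    case False
    then have pos: "0 < ip y y"
      using nonneg[of y] by simp
    have "0 \<le> ip (ip y y *\<^sub>R x - ip x y *\<^sub>R y) (ip y y *\<^sub>R x - ip x y *\<^sub>R y)"
      by (rule nonneg)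
    also have "\<dots> = ip y y * (ip x x * ip y y - (ip x y)\<^sup>2)"
      by (simp add: diff_left diff_right scaleR_left scaleR_right commute[of y x]
          power2_eq_square algebra_simps)
    finally show ?thesis
      using pos by (simp add: zero_le_mult_iff)
  next
    case True
    have "ip x y = 0"
    proof (rule ccontr)
      assume nz: "ip x y \<noteq> 0"
      \<comment> \<open>Along a null vector the quadratic expression is linear in the parameter;
        this value makes it \<open>- 1\<close>.\<close>
      let ?t = "(ip x x + 1) / (2 * ip x y)"
      have "0 \<le> ip (x - ?t *\<^sub>R y) (x - ?t *\<^sub>R y)"
        by (rule nonneg)
      also have "\<dots> = ip x x - ?t * (2 * ip x y)"
        by (simp add: diff_left diff_right scaleR_left scaleR_right commute[of y x] True)
      finally show False
        using nz by simp
    qed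
    then show ?thesis
      by (simp add: nonneg)
  qed
  then have "sqrt ((ip x y)\<^sup>2) \<le> sqrt (ip x x * ip y y)"
    by (rule real_sqrt_le_mono)
  then show ?thesis
    by (simp add: ip_norm_def real_sqrt_mult)
qed

lemma nrm_triangle: "nrm (x + y) \<le> nrm x + nrm y"
proof (rule power2_le_imp_le)
  have "(nrm (x + y))\<^sup>2 = (nrm x)\<^sup>2 + 2 * ip x y + (nrm y)\<^sup>2"
    unfolding nrm_power2 by (simp add: add_left add_right commute[of y x])
  also have "\<dots> \<le> (nrm x + nrm y)\<^sup>2"
    using cauchy_schwarz[of x y] by (simp add: power2_sum)
  finally show "(nrm (x + y))\<^sup>2 \<le> (nrm x + nrm y)\<^sup>2" .
qed (simp add: nrm_nonneg)

lemma nrm_triangle_diff: "nrm (x - z) \<le> nrm (x - y) + nrm (y - z)"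
  using nrm_triangle[of "x - y" "y - z"] by simp

lemma nrm_diff_abs: "\<bar>nrm x - nrm y\<bar> \<le> nrm (x - y)"
  using nrm_triangle[of "x - y" y] nrm_triangle[of "y - x" x] nrm_minus_commute[of x y] by simp

lemma CauchyI_sum:
  assumes "\<And>e. 0 < e \<Longrightarrow> \<exists>N. \<forall>m\<ge>N. \<forall>n\<ge>N. nrm (s m - s n) < 2 * e"
  shows "s \<in> ip_Cauchy ip"
  unfolding ip_Cauchy_def using assms[of "e / 2" for e] by auto

lemma Cauchy_const: "(\<lambda>n. x) \<in> ip_Cauchy ip"
  by (simp add: ip_Cauchy_def nrm_zero)

lemma Cauchy_add:
  assumes "s \<in> ip_Cauchy ip" "t \<in> ip_Cauchy ip"
  shows "(\<lambda>n. s n + t n) \<in> ip_Cauchy ip"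
proof (rule CauchyI_sum)
  fix e :: real assume e: "0 < e"
  obtain M where M: "\<And>m n. M \<le> m \<Longrightarrow> M \<le> n \<Longrightarrow> nrm (s m - s n) < e"
    using assms(1) e unfolding ip_Cauchy_def by blast
  obtain N where N: "\<And>m n. N \<le> m \<Longrightarrow> N \<le> n \<Longrightarrow> nrm (t m - t n) < e"
    using assms(2) e unfolding ip_Cauchy_def by blast
  have "nrm (s m + t m - (s n + t n)) < 2 * e" if "max M N \<le> m" "max M N \<le> n" for m n
    using that M[of m n] N[of m n] nrm_triangle[of "s m - s n" "t m - t n"]
    by (simp add: add_diff_add)
  then show "\<exists>N. \<forall>m\<ge>N. \<forall>n\<ge>N. nrm (s m + t m - (s n + t n)) < 2 * e"
    by blast
qed

lemma Cauchy_scaleR: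
  assumes "s \<in> ip_Cauchy ip"
  shows "(\<lambda>n. c *\<^sub>R s n) \<in> ip_Cauchy ip"
  unfolding ip_Cauchy_def
proof (intro CollectI allI impI)
  fix e :: real assume "0 < e"
  then have "0 < e / (\<bar>c\<bar> + 1)"
    by simp
  then obtain N where N: "\<And>m n. N \<le> m \<Longrightarrow> N \<le> n \<Longrightarrow> nrm (s m - s n) < e / (\<bar>c\<bar> + 1)"
    using assms unfolding ip_Cauchy_def by blast
  have "nrm (c *\<^sub>R s m - c *\<^sub>R s n) < e" if "N \<le> m" "N \<le> n" for m n
  proof -
    have "nrm (c *\<^sub>R s m - c *\<^sub>R s n) \<le> (\<bar>c\<bar> + 1) * nrm (s m - s n)"
      by (simp add: nrm_scaleR scaleR_diff_right[symmetric] nrm_nonneg distrib_right)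
    also have "\<dots> < e"
      using N[OF that] by (simp add: field_simps)
    finally show ?thesis .
  qed
  then show "\<exists>N. \<forall>m\<ge>N. \<forall>n\<ge>N. nrm (c *\<^sub>R s m - c *\<^sub>R s n) < e"
    by blast
qed

lemma Cauchy_diff:
  assumes "s \<in> ip_Cauchy ip" "t \<in> ip_Cauchy ip"
  shows "(\<lambda>n. s n - t n) \<in> ip_Cauchy ip"
  using Cauchy_add[OF assms(1) Cauchy_scaleR[OF assms(2), of "- 1"]] by simp

lemma nrm_convergent:
  assumes "s \<in> ip_Cauchy ip"
  shows "convergent (\<lambda>n. nrm (s n))"
proof -
  have "Cauchy (\<lambda>n. nrm (s n))"
  proof (rule metric_CauchyI)
    fix e :: real assume "0 < e"
    then obtain N where N: "\<And>m n. N \<le> m \<Longrightarrow> N \<le> n \<Longrightarrow> nrm (s m - s n) < e"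
      using assms unfolding ip_Cauchy_def by blast
    then show "\<exists>N. \<forall>m\<ge>N. \<forall>n\<ge>N. dist (nrm (s m)) (nrm (s n)) < e"
      using nrm_diff_abs by (metis dist_real_def le_less_trans)
  qed
  then show ?thesis
    by (simp add: Cauchy_convergent_iff)
qed

text \<open>Polarisation expresses \<open>ip\<close> by norms of sums and differences, which are
  again Cauchy sequences.\<close>

lemma ip_convergent:
  assumes "s \<in> ip_Cauchy ip" "t \<in> ip_Cauchy ip"
  shows "convergent (\<lambda>n. ip (s n) (t n))"
proof -
  have "ip x y = ((nrm (x + y))\<^sup>2 - (nrm (x - y))\<^sup>2) / 4" for x y
    unfolding nrm_power2 by (simp add: add_left add_right diff_left diff_right commute[of y x])
  moreover obtain a b where "(\<lambda>n. nrm (s n + t n)) \<longlonglongrightarrow> a" "(\<lambda>n. nrm (s n - t n)) \<longlonglongrightarrow> b"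
    using nrm_convergent[OF Cauchy_add[OF assms]] nrm_convergent[OF Cauchy_diff[OF assms]]
    unfolding convergent_def by blast
  then have "(\<lambda>n. ((nrm (s n + t n))\<^sup>2 - (nrm (s n - t n))\<^sup>2) / 4) \<longlonglongrightarrow> (a\<^sup>2 - b\<^sup>2) / 4"
    by (intro tendsto_intros) auto
  ultimately show ?thesis
    unfolding convergent_def by (simp only:) blast
qed

lemma ip_tendsto_zero:
  assumes "(\<lambda>n. nrm (s n)) \<longlonglongrightarrow> 0" "t \<in> ip_Cauchy ip"
  shows "(\<lambda>n. ip (s n) (t n)) \<longlonglongrightarrow> 0"
proof -
  obtain a where "(\<lambda>n. nrm (t n)) \<longlonglongrightarrow> a"
    using nrm_convergent[OF assms(2)] unfolding convergent_def by blast
  then have "(\<lambda>n. nrm (s n) * nrm (t n)) \<longlonglongrightarrow> 0"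
    using tendsto_mult[OF assms(1)] by fastforce
  then show ?thesis
    by (rule Lim_null_comparison[rotated]) (simp add: cauchy_schwarz)
qed

section \<open>Equivalence classes of Cauchy sequences\<close>

abbreviation (input) cls :: "(nat \<Rightarrow> 'a) \<Rightarrow> (nat \<Rightarrow> 'a) set" where
  "cls s \<equiv> ip_Cauchy_rel ip `` {s}"

lemma equiv_Cauchy_rel: "equiv (ip_Cauchy ip) (ip_Cauchy_rel ip)"
proof (rule equivI)
  show "ip_Cauchy_rel ip \<subseteq> ip_Cauchy ip \<times> ip_Cauchy ip"
    by (auto simp: ip_Cauchy_rel_def)
  show "refl_on (ip_Cauchy ip) (ip_Cauchy_rel ip)"
    by (auto simp: refl_on_def ip_Cauchy_rel_def nrm_zero)
  show "sym (ip_Cauchy_rel ip)"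
    by (auto simp: sym_def ip_Cauchy_rel_def nrm_minus_commute)
  show "trans (ip_Cauchy_rel ip)"
  proof (rule transI)
    fix s t u assume st: "(s, t) \<in> ip_Cauchy_rel ip" and tu: "(t, u) \<in> ip_Cauchy_rel ip"
    then have "(\<lambda>n. nrm (s n - t n) + nrm (t n - u n)) \<longlonglongrightarrow> 0"
      unfolding ip_Cauchy_rel_def by (intro tendsto_add_zero) auto
    then have "(\<lambda>n. nrm (s n - u n)) \<longlonglongrightarrow> 0"
      by (rule Lim_null_comparison[rotated]) (simp add: nrm_triangle_diff nrm_nonneg)
    with st tu show "(s, u) \<in> ip_Cauchy_rel ip"
      by (auto simp: ip_Cauchy_rel_def)
  qed
qed

lemma cls_self: "s \<in> ip_Cauchy ip \<Longrightarrow> s \<in> cls s"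
  by (rule equiv_class_self[OF equiv_Cauchy_rel])

lemma cls_in_completion: "s \<in> ip_Cauchy ip \<Longrightarrow> cls s \<in> ip_completion ip"
  unfolding ip_completion_def by (rule quotientI)

lemma cls_eq:
  assumes "A \<in> ip_completion ip" "s \<in> A"
  shows "A = cls s"
proof -
  obtain u where "A = cls u"
    using assms(1) unfolding ip_completion_def by (rule quotientE)
  with assms(2) show ?thesis
    using equiv_class_eq[OF equiv_Cauchy_rel, of u s] by simp
qed

lemma completion_mem_rel:
  assumes "A \<in> ip_completion ip" "s \<in> A" "t \<in> A"
  shows "(s, t) \<in> ip_Cauchy_rel ip"
  using cls_eq[OF assms(1,2)] assms(3) by auto

lemma completion_mem_Cauchy: "A \<in> ip_completion ip \<Longrightarrow> s \<in> A \<Longrightarrow> s \<in> ip_Cauchy ip"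
  using completion_mem_rel[of A s s] by (simp add: ip_Cauchy_rel_def)

lemma completion_cases:
  assumes "A \<in> ip_completion ip"
  obtains s where "s \<in> ip_Cauchy ip" "A = cls s"
  using assms unfolding ip_completion_def by (rule quotientE)

text \<open>Operating on representatives need not fill a class: scaling by 0 leaves the zero
  sequence alone. Closing under the relation yields a full class once everything lies in a single
  one.\<close>

lemma Image_Cauchy_rel_eq_cls:
  assumes "u \<in> X" "X \<subseteq> cls u"
  shows "ip_Cauchy_rel ip `` X = cls u"
proof (intro equalityI subsetI)
  fix v assume "v \<in> ip_Cauchy_rel ip `` X"
  then obtain w where "w \<in> X" "(w, v) \<in> ip_Cauchy_rel ip"
    by blast
  then have "(u, w) \<in> ip_Cauchy_rel ip" "(w, v) \<in> ip_Cauchy_rel ip"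
    using assms(2) by auto
  then show "v \<in> cls u"
    using equiv_Cauchy_rel by (auto simp: equiv_def dest: transD)
qed (use assms(1) in blast)

lemma completion_add_cls:
  assumes s: "s \<in> ip_Cauchy ip" and t: "t \<in> ip_Cauchy ip"
  shows "completion_add ip (cls s) (cls t) = cls (\<lambda>n. s n + t n)"
  unfolding completion_add_def
proof (rule Image_Cauchy_rel_eq_cls)
  show "(\<lambda>n. s n + t n) \<in> {\<lambda>n. s' n + t' n |s' t'. s' \<in> cls s \<and> t' \<in> cls t}"
    using cls_self s t by blast
  show "{\<lambda>n. s' n + t' n |s' t'. s' \<in> cls s \<and> t' \<in> cls t} \<subseteq> cls (\<lambda>n. s n + t n)"
  proof clarify
    fix s' t' assume "(s, s') \<in> ip_Cauchy_rel ip" "(t, t') \<in> ip_Cauchy_rel ip"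
    then have C: "s' \<in> ip_Cauchy ip" "t' \<in> ip_Cauchy ip"
      and "(\<lambda>n. nrm (s n - s' n)) \<longlonglongrightarrow> 0" "(\<lambda>n. nrm (t n - t' n)) \<longlonglongrightarrow> 0"
      by (auto simp: ip_Cauchy_rel_def)
    then have "(\<lambda>n. nrm (s n - s' n) + nrm (t n - t' n)) \<longlonglongrightarrow> 0"
      by (intro tendsto_add_zero)
    then have "(\<lambda>n. nrm (s n + t n - (s' n + t' n))) \<longlonglongrightarrow> 0"
      unfolding add_diff_add
      by (rule Lim_null_comparison[rotated]) (simp add: nrm_triangle nrm_nonneg)
    then show "((\<lambda>n. s n + t n), (\<lambda>n. s' n + t' n)) \<in> ip_Cauchy_rel ip"
      using s t C by (simp add: ip_Cauchy_rel_def Cauchy_add)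
  qed
qed

lemma completion_scale_cls:
  assumes s: "s \<in> ip_Cauchy ip"
  shows "completion_scale ip c (cls s) = cls (\<lambda>n. c *\<^sub>R s n)"
  unfolding completion_scale_def
proof (rule Image_Cauchy_rel_eq_cls)
  show "(\<lambda>n. c *\<^sub>R s n) \<in> {\<lambda>n. c *\<^sub>R s' n |s'. s' \<in> cls s}"
    using cls_self s by blast
  show "{\<lambda>n. c *\<^sub>R s' n |s'. s' \<in> cls s} \<subseteq> cls (\<lambda>n. c *\<^sub>R s n)"
  proof clarify
    fix s' assume "(s, s') \<in> ip_Cauchy_rel ip"
    then have C: "s' \<in> ip_Cauchy ip" and "(\<lambda>n. nrm (s n - s' n)) \<longlonglongrightarrow> 0"
      by (auto simp: ip_Cauchy_rel_def)
    then have "(\<lambda>n. \<bar>c\<bar> * nrm (s n - s' n)) \<longlonglongrightarrow> \<bar>c\<bar> * 0"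
      by (intro tendsto_mult_left)
    then show "((\<lambda>n. c *\<^sub>R s n), (\<lambda>n. c *\<^sub>R s' n)) \<in> ip_Cauchy_rel ip"
      using s C by (simp add: ip_Cauchy_rel_def Cauchy_scaleR nrm_scaleR scaleR_diff_right[symmetric])
  qed
qed

lemma completion_inner_tendsto:
  assumes A: "A \<in> ip_completion ip" "s \<in> A" and B: "B \<in> ip_completion ip" "t \<in> B"
  shows "(\<lambda>n. ip (s n) (t n)) \<longlonglongrightarrow> completion_inner ip A B"
proof -
  obtain r where r: "(\<lambda>n. ip (s n) (t n)) \<longlonglongrightarrow> r"
    using ip_convergent completion_mem_Cauchy A B unfolding convergent_def by metis
  have all: "(\<lambda>n. ip (s' n) (t' n)) \<longlonglongrightarrow> r" if "s' \<in> A" "t' \<in> B" for s' t'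
  proof -
    have "(\<lambda>n. ip (s' n - s n) (t' n)) \<longlonglongrightarrow> 0" "(\<lambda>n. ip (t' n - t n) (s n)) \<longlonglongrightarrow> 0"
      using completion_mem_rel[OF A(1) that(1) A(2)] completion_mem_rel[OF B(1) that(2) B(2)]
      by (auto simp: ip_Cauchy_rel_def intro!: ip_tendsto_zero)
    \<comment> \<open>The three summands add up to \<open>ip (s' n) (t' n)\<close>, so other
      representatives give the same limit.\<close>
    with r have "(\<lambda>n. ip (s n) (t n) + ip (s' n - s n) (t' n) + ip (t' n - t n) (s n)) \<longlonglongrightarrow> r + 0 + 0"
      by (intro tendsto_add)
    then show ?thesis
      by (simp add: diff_left commute[of "s _"])
  qed
  have "completion_inner ip A B = r"
    unfolding completion_inner_def
  proof (rule the_equality)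
    fix r' assume "\<forall>s\<in>A. \<forall>t\<in>B. (\<lambda>n. ip (s n) (t n)) \<longlonglongrightarrow> r'"
    with A(2) B(2) have "(\<lambda>n. ip (s n) (t n)) \<longlonglongrightarrow> r'"
      by blast
    then show "r' = r"
      using r by (rule LIMSEQ_unique)
  qed (use all in blast)
  with r show ?thesis
    by simp
qed

end

text \<open>The first assumption bounds the evaluations, which therefore extend to the completion. A
  nonzero element of the completion could still vanish at every point; the second assumption
  excludes this.\<close>

locale kernel_space = semi_inner ip for ip :: "'a::real_vector \<Rightarrow> 'a \<Rightarrow> real" +
  fixes ev :: "'a \<Rightarrow> 't \<Rightarrow> real" and kp :: "'t \<Rightarrow> 'a" and T :: "'t set"
  assumes reproducing: "t \<in> T \<Longrightarrow> ip x (kp t) = ev x t"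
    and nrm_tendsto_zero: "s \<in> ip_Cauchy ip \<Longrightarrow> (\<And>t. t \<in> T \<Longrightarrow> (\<lambda>n. ev (s n) t) \<longlonglongrightarrow> 0) \<Longrightarrow>
      (\<lambda>n. ip_norm ip (s n)) \<longlonglongrightarrow> 0"
begin

abbreviation (input) "X \<equiv> ip_completion ip"

definition fn :: "(nat \<Rightarrow> 'a) set \<Rightarrow> 't \<Rightarrow> real" where
  "fn A = (\<lambda>t\<in>T. completion_extend (\<lambda>x. ev x t) A)"

definition fip :: "('t \<Rightarrow> real) \<Rightarrow> ('t \<Rightarrow> real) \<Rightarrow> real" where
  "fip f g = completion_inner ip (inv_into X fn f) (inv_into X fn g)"

lemma ev_bound: "t \<in> T \<Longrightarrow> \<bar>ev x t\<bar> \<le> nrm (kp t) * nrm x"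
  using cauchy_schwarz[of x "kp t"] by (simp add: reproducing mult.commute)

text \<open>Evaluation at \<open>t\<close> is pairing with \<open>kp t\<close>, so the limit behind
  \<open>completion_extend\<close> exists and is the same for all representatives.\<close>

lemma fn_eq_inner:
  assumes A: "A \<in> X" and t: "t \<in> T"
  shows "fn A t = completion_inner ip A (cls (\<lambda>n. kp t))"
proof -
  have lim: "(\<lambda>n. ev (s n) t) \<longlonglongrightarrow> completion_inner ip A (cls (\<lambda>n. kp t))" if "s \<in> A" for s
    using completion_inner_tendsto[OF A that cls_in_completion cls_self,
        OF Cauchy_const Cauchy_const, of "kp t"]
    by (simp add: reproducing t)
  obtain s where s: "s \<in> A"
    using completion_cases[OF A] cls_self by metis
  have "completion_extend (\<lambda>x. ev x t) A = completion_inner ip A (cls (\<lambda>n. kp t))"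
    unfolding completion_extend_def
  proof (rule the_equality)
    fix r assume "\<forall>s\<in>A. (\<lambda>n. ev (s n) t) \<longlonglongrightarrow> r"
    with s have "(\<lambda>n. ev (s n) t) \<longlonglongrightarrow> r"
      by blast
    then show "r = completion_inner ip A (cls (\<lambda>n. kp t))"
      using lim[OF s] by (rule LIMSEQ_unique)
  qed (use lim in blast)
  then show ?thesis
    using t by (simp add: fn_def)
qed

lemma fn_tendsto:
  assumes "A \<in> X" "s \<in> A" "t \<in> T"
  shows "(\<lambda>n. ev (s n) t) \<longlonglongrightarrow> fn A t"
  using completion_inner_tendsto[OF assms(1,2) cls_in_completion cls_self,
      OF Cauchy_const Cauchy_const, of "kp t"]
  by (simp add: reproducing assms fn_eq_inner)

lemma fn_cls_tendsto:
  assumes "s \<in> ip_Cauchy ip" "t \<in> T"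
  shows "(\<lambda>n. ev (s n) t) \<longlonglongrightarrow> fn (cls s) t"
  using fn_tendsto cls_in_completion cls_self assms by blast

lemma fn_cls_eqI:
  assumes "s \<in> ip_Cauchy ip" "\<And>t. t \<in> T \<Longrightarrow> (\<lambda>n. ev (s n) t) \<longlonglongrightarrow> f t"
  shows "fn (cls s) = (\<lambda>t\<in>T. f t)"
proof
  fix t
  show "fn (cls s) t = (\<lambda>t\<in>T. f t) t"
    using LIMSEQ_unique[OF fn_cls_tendsto[OF assms(1)] assms(2)] by (cases "t \<in> T") (auto simp: fn_def)
qed

lemma ev_add: "t \<in> T \<Longrightarrow> ev (x + y) t = ev x t + ev y t"
  by (simp add: reproducing[symmetric] add_left)

lemma ev_diff: "t \<in> T \<Longrightarrow> ev (x - y) t = ev x t - ev y t"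
  by (simp add: reproducing[symmetric] diff_left)

lemma ev_scaleR: "t \<in> T \<Longrightarrow> ev (c *\<^sub>R x) t = c * ev x t"
  by (simp add: reproducing[symmetric] scaleR_left)

lemma fn_embed: "fn (completion_embed ip x) = (\<lambda>t\<in>T. ev x t)"
  unfolding completion_embed_def by (rule fn_cls_eqI) (auto simp: Cauchy_const)

lemma fn_cls_add:
  assumes "s \<in> ip_Cauchy ip" "u \<in> ip_Cauchy ip"
  shows "fn (cls (\<lambda>n. s n + u n)) = (\<lambda>t\<in>T. fn (cls s) t + fn (cls u) t)"
  using assms by (intro fn_cls_eqI Cauchy_add) (auto simp: ev_add intro!: tendsto_add fn_cls_tendsto)

lemma fn_cls_diff:
  assumes "s \<in> ip_Cauchy ip" "u \<in> ip_Cauchy ip"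
  shows "fn (cls (\<lambda>n. s n - u n)) = (\<lambda>t\<in>T. fn (cls s) t - fn (cls u) t)"
  using assms by (intro fn_cls_eqI Cauchy_diff) (auto simp: ev_diff intro!: tendsto_diff fn_cls_tendsto)

lemma fn_cls_scaleR:
  assumes "s \<in> ip_Cauchy ip"
  shows "fn (cls (\<lambda>n. c *\<^sub>R s n)) = (\<lambda>t\<in>T. c * fn (cls s) t)"
  using assms by (intro fn_cls_eqI Cauchy_scaleR)
    (auto simp: ev_scaleR intro!: tendsto_mult_left fn_cls_tendsto)

lemma fn_add: "A \<in> X \<Longrightarrow> B \<in> X \<Longrightarrow> fn (completion_add ip A B) = (\<lambda>t\<in>T. fn A t + fn B t)"
  by (elim completion_cases) (simp add: completion_add_cls fn_cls_add)

lemma fn_scale: "A \<in> X \<Longrightarrow> fn (completion_scale ip c A) = (\<lambda>t\<in>T. c * fn A t)"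
  by (elim completion_cases) (simp add: completion_scale_cls fn_cls_scaleR)

lemma inj_on_fn: "inj_on fn X"
proof (rule inj_onI)
  fix A B assume A: "A \<in> X" and B: "B \<in> X" and eq: "fn A = fn B"
  obtain s u where s: "s \<in> ip_Cauchy ip" "A = cls s" and u: "u \<in> ip_Cauchy ip" "B = cls u"
    using completion_cases A B by metis
  have "(\<lambda>n. nrm (s n - u n)) \<longlonglongrightarrow> 0"
  proof (rule nrm_tendsto_zero[OF Cauchy_diff[OF s(1) u(1)]])
    fix t assume t: "t \<in> T"
    show "(\<lambda>n. ev (s n - u n) t) \<longlonglongrightarrow> 0"
      using tendsto_diff[OF fn_cls_tendsto[OF s(1) t] fn_cls_tendsto[OF u(1) t]] eq s(2) u(2)
      by (simp add: ev_diff t)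
  qed
  then have "(s, u) \<in> ip_Cauchy_rel ip"
    using s(1) u(1) by (simp add: ip_Cauchy_rel_def)
  then show "A = B"
    using equiv_class_eq[OF equiv_Cauchy_rel] s(2) u(2) by simp
qed

text \<open>Injectivity undoes \<open>inv_into\<close>, so identities for \<open>fip\<close> can be
  checked as limits along representatives.\<close>

lemma fip_tendsto:
  assumes "s \<in> ip_Cauchy ip" "u \<in> ip_Cauchy ip"
  shows "(\<lambda>n. ip (s n) (u n)) \<longlonglongrightarrow> fip (fn (cls s)) (fn (cls u))"
  using completion_inner_tendsto[OF cls_in_completion cls_self cls_in_completion cls_self,
      OF assms(1) assms(1) assms(2) assms(2)]
  by (simp add: fip_def inv_into_f_f[OF inj_on_fn] cls_in_completion assms)

lemma fip_norm_tendsto: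
  assumes "s \<in> ip_Cauchy ip"
  shows "(\<lambda>n. nrm (s n)) \<longlonglongrightarrow> ip_norm fip (fn (cls s))"
  using tendsto_real_sqrt[OF fip_tendsto[OF assms assms]] by (simp add: ip_norm_def[abs_def])

lemma fn_image_cases:
  assumes "f \<in> fn ` X"
  obtains s where "s \<in> ip_Cauchy ip" "f = fn (cls s)"
  using assms completion_cases by blast

lemma fn_cls_in_image: "s \<in> ip_Cauchy ip \<Longrightarrow> fn (cls s) \<in> fn ` X"
  by (intro imageI cls_in_completion)

lemma fn_cls_zero: "fn (cls (\<lambda>n. 0)) = (\<lambda>t\<in>T. 0)"
  using ev_scaleR[of _ 0 0] by (intro fn_cls_eqI) (auto simp: Cauchy_const)

lemma function_subspace_fn: "function_subspace T (fn ` X)"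
  unfolding function_subspace_def
proof (intro conjI ballI allI)
  show "fn ` X \<subseteq> extensional T"
    by (auto simp: fn_def)
  show "(\<lambda>t\<in>T. 0) \<in> fn ` X"
    using fn_cls_in_image[OF Cauchy_const] by (simp add: fn_cls_zero[symmetric])
  fix f g and c :: real
  assume f: "f \<in> fn ` X"
  then obtain s where s: "s \<in> ip_Cauchy ip" "f = fn (cls s)"
    by (rule fn_image_cases)
  then show "(\<lambda>t\<in>T. c * f t) \<in> fn ` X"
    by (simp add: fn_cls_scaleR[symmetric] fn_cls_in_image Cauchy_scaleR)
  assume "g \<in> fn ` X"
  then obtain u where "u \<in> ip_Cauchy ip" "g = fn (cls u)"
    by (rule fn_image_cases)
  with s show "(\<lambda>t\<in>T. f t + g t) \<in> fn ` X"
    by (simp add: fn_cls_add[symmetric] fn_cls_in_image Cauchy_add)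
qed

lemma function_inner_product_fn: "function_inner_product T (fn ` X) fip"
  unfolding function_inner_product_def
proof (intro conjI ballI allI impI)
  fix f g h and c :: real
  assume "f \<in> fn ` X"
  then obtain s where s: "s \<in> ip_Cauchy ip" "f = fn (cls s)"
    by (rule fn_image_cases)
  show "0 < fip f f" if "f \<noteq> (\<lambda>t\<in>T. 0)"
  proof (rule ccontr)
    assume "\<not> 0 < fip f f"
    moreover have "0 \<le> fip f f"
      using fip_tendsto[OF s(1) s(1)] nonneg by (auto simp: s(2) intro: LIMSEQ_le_const)
    ultimately have "(\<lambda>n. nrm (s n)) \<longlonglongrightarrow> 0"
      using fip_norm_tendsto[OF s(1)] by (simp add: ip_norm_def[of fip] s(2))
    \<comment> \<open>A null sequence pairs to 0 with every kernel point, so its limit function is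
      0; this gives definiteness.\<close>
    then have "(\<lambda>n. ip (s n) (kp t)) \<longlonglongrightarrow> 0" for t
      by (rule ip_tendsto_zero[OF _ Cauchy_const])
    then have "f = (\<lambda>t\<in>T. 0)"
      unfolding s(2) by (intro fn_cls_eqI s(1)) (simp add: reproducing[symmetric])
    with that show False ..
  qed
  assume "h \<in> fn ` X"
  then obtain v where v: "v \<in> ip_Cauchy ip" "h = fn (cls v)"
    by (rule fn_image_cases)
  show "fip (\<lambda>t\<in>T. c * f t) h = c * fip f h"
    using tendsto_mult_left[OF fip_tendsto[OF s(1) v(1)], of c]
      fip_tendsto[OF Cauchy_scaleR[OF s(1), of c] v(1)]
    by (auto simp: s v fn_cls_scaleR scaleR_left intro: LIMSEQ_unique)
  show "fip f h = fip h f"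
    using fip_tendsto[OF s(1) v(1)] fip_tendsto[OF v(1) s(1)]
    by (auto simp: s(2) v(2) commute[of "s _"] intro: LIMSEQ_unique)
  assume "g \<in> fn ` X"
  then obtain u where u: "u \<in> ip_Cauchy ip" "g = fn (cls u)"
    by (rule fn_image_cases)
  show "fip (\<lambda>t\<in>T. f t + g t) h = fip f h + fip g h"
    using tendsto_add[OF fip_tendsto[OF s(1) v(1)] fip_tendsto[OF u(1) v(1)]]
      fip_tendsto[OF Cauchy_add[OF s(1) u(1)] v(1)]
    by (auto simp: s u v fn_cls_add add_left intro: LIMSEQ_unique)
qed

lemma function_complete_fn: "function_complete T (fn ` X) fip"
  unfolding function_complete_def
proof (intro allI impI)
  fix F :: "nat \<Rightarrow> 't \<Rightarrow> real"
  assume F: "\<forall>n. F n \<in> fn ` X"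
    and cau: "\<forall>e>0. \<exists>N. \<forall>m\<ge>N. \<forall>n\<ge>N. ip_norm fip (\<lambda>t\<in>T. F m t - F n t) < e"
  have "\<exists>s. s \<in> ip_Cauchy ip \<and> F n = fn (cls s)" for n
    using fn_image_cases[of "F n"] F by blast
  then obtain \<sigma> where \<sigma>: "\<And>n. \<sigma> n \<in> ip_Cauchy ip" "\<And>n. F n = fn (cls (\<sigma> n))"
    by metis
  have dist: "(\<lambda>j. nrm (\<sigma> m j - \<sigma> n j)) \<longlonglongrightarrow> ip_norm fip (\<lambda>t\<in>T. F m t - F n t)" for m n
    using fip_norm_tendsto[OF Cauchy_diff[OF \<sigma>(1) \<sigma>(1)]] by (simp add: \<sigma> fn_cls_diff)
  have "\<exists>N. \<forall>j\<ge>N. nrm (\<sigma> n j - \<sigma> n N) < inverse (real (Suc n))" for n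
  proof -
    have "0 < inverse (real (Suc n))"
      by simp
    then obtain N where "\<forall>i\<ge>N. \<forall>j\<ge>N. nrm (\<sigma> n i - \<sigma> n j) < inverse (real (Suc n))"
      using \<sigma>(1)[of n] unfolding ip_Cauchy_def by blast
    then show ?thesis
      by blast
  qed
  then obtain \<nu> where \<nu>: "\<And>n j. \<nu> n \<le> j \<Longrightarrow> nrm (\<sigma> n j - \<sigma> n (\<nu> n)) < inverse (real (Suc n))"
    by metis
  \<comment> \<open>A diagonal sequence represents the limit.\<close>
  define u where "u = (\<lambda>n. \<sigma> n (\<nu> n))"
  \<comment> \<open>Both sequences are compared at a large common index \<open>j\<close>, where they
    are close to \<open>u m\<close> and \<open>u n\<close>; then \<open>j\<close> tends to
    infinity.\<close>
  have u_dist: "nrm (u m - u n)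
      \<le> inverse (real (Suc m)) + ip_norm fip (\<lambda>t\<in>T. F m t - F n t) + inverse (real (Suc n))" for m n
  proof (rule LIMSEQ_le_const)
    show "(\<lambda>j. inverse (real (Suc m)) + nrm (\<sigma> m j - \<sigma> n j) + inverse (real (Suc n)))
      \<longlonglongrightarrow> inverse (real (Suc m)) + ip_norm fip (\<lambda>t\<in>T. F m t - F n t) + inverse (real (Suc n))"
      by (intro tendsto_intros dist)
    have "nrm (u m - u n) \<le> inverse (real (Suc m)) + nrm (\<sigma> m j - \<sigma> n j) + inverse (real (Suc n))"
      if "max (\<nu> m) (\<nu> n) \<le> j" for j
      using \<nu>[of m j] \<nu>[of n j] that nrm_triangle_diff[of "u m" "u n" "\<sigma> m j"]
        nrm_triangle_diff[of "\<sigma> m j" "u n" "\<sigma> n j"] nrm_minus_commute[of "u m" "\<sigma> m j"]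
      by (simp add: u_def)
    then show "\<exists>N. \<forall>j\<ge>N. nrm (u m - u n)
        \<le> inverse (real (Suc m)) + nrm (\<sigma> m j - \<sigma> n j) + inverse (real (Suc n))"
      by blast
  qed
  have small: "\<exists>N. \<forall>n\<ge>N. inverse (real (Suc n)) < e" if "0 < e" for e
    using that LIMSEQ_inverse_real_of_nat unfolding LIMSEQ_iff by simp
  have u: "u \<in> ip_Cauchy ip"
    unfolding ip_Cauchy_def
  proof (intro CollectI allI impI)
    fix e :: real assume e: "0 < e"
    obtain M where M: "\<And>m n. M \<le> m \<Longrightarrow> M \<le> n \<Longrightarrow> ip_norm fip (\<lambda>t\<in>T. F m t - F n t) < e / 3"
      using cau e by (metis zero_less_divide_iff zero_less_numeral)
    obtain N where N: "\<And>n. N \<le> n \<Longrightarrow> inverse (real (Suc n)) < e / 3"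
      using small[of "e / 3"] e by auto
    have "nrm (u m - u n) < e" if "max M N \<le> m" "max M N \<le> n" for m n
      using that M[of m n] N[of m] N[of n] u_dist[of m n] by simp
    then show "\<exists>N. \<forall>m\<ge>N. \<forall>n\<ge>N. nrm (u m - u n) < e"
      by blast
  qed
  have "(\<lambda>n. ip_norm fip (\<lambda>t\<in>T. F n t - fn (cls u) t)) \<longlonglongrightarrow> 0"
  proof (rule LIMSEQ_I)
    fix e :: real assume e: "0 < e"
    then have "0 < e / 4"
      by simp
    then obtain M where M: "\<And>m n. M \<le> m \<Longrightarrow> M \<le> n \<Longrightarrow> nrm (u m - u n) < e / 4"
      using u unfolding ip_Cauchy_def by blast
    obtain N where N: "\<And>n. N \<le> n \<Longrightarrow> inverse (real (Suc n)) < e / 4"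
      using small[of "e / 4"] e by auto
    have "norm (ip_norm fip (\<lambda>t\<in>T. F n t - fn (cls u) t) - 0) < e" if n: "max M N \<le> n" for n
    proof -
      have lim: "(\<lambda>j. nrm (\<sigma> n j - u j)) \<longlonglongrightarrow> ip_norm fip (\<lambda>t\<in>T. F n t - fn (cls u) t)"
        using fip_norm_tendsto[OF Cauchy_diff[OF \<sigma>(1) u]] by (simp add: \<sigma> u fn_cls_diff)
      \<comment> \<open>\<open>e / 4\<close> from \<open>\<sigma> n j\<close> to \<open>u n\<close>,
        and \<open>e / 4\<close> from there to \<open>u j\<close>.\<close>
      have "nrm (\<sigma> n j - u j) \<le> e / 2" if "max (\<nu> n) M \<le> j" for j
        using \<nu>[of n j] N[of n] M[of n j] n that nrm_triangle_diff[of "\<sigma> n j" "u j" "u n"]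
        by (simp add: u_def)
      then have "ip_norm fip (\<lambda>t\<in>T. F n t - fn (cls u) t) \<le> e / 2"
        by (intro LIMSEQ_le_const2[OF lim]) blast
      moreover have "0 \<le> ip_norm fip (\<lambda>t\<in>T. F n t - fn (cls u) t)"
        by (intro LIMSEQ_le_const[OF lim]) (simp add: nrm_nonneg)
      ultimately show ?thesis
        using e by simp
    qed
    then show "\<exists>N. \<forall>n\<ge>N. norm (ip_norm fip (\<lambda>t\<in>T. F n t - fn (cls u) t) - 0) < e"
      by blast
  qed
  then show "\<exists>f\<in>fn ` X. (\<lambda>n. ip_norm fip (\<lambda>t\<in>T. F n t - f t)) \<longlonglongrightarrow> 0"
    using fn_cls_in_image[OF u] by blast
qed

lemma rkhs_fn: "rkhs T (fn ` X) fip (\<lambda>s t. ev (kp t) s)"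
  unfolding rkhs_def
proof (intro conjI ballI function_subspace_fn function_inner_product_fn function_complete_fn)
  fix t assume t: "t \<in> T"
  have k: "(\<lambda>s\<in>T. ev (kp t) s) = fn (cls (\<lambda>n. kp t))"
    by (rule fn_cls_eqI[symmetric]) (auto simp: Cauchy_const)
  then show "(\<lambda>s\<in>T. ev (kp t) s) \<in> fn ` X"
    by (simp add: fn_cls_in_image Cauchy_const)
  have "\<bar>f t\<bar> \<le> nrm (kp t) * ip_norm fip f" if f: "f \<in> fn ` X" for f
  proof -
    obtain s where s: "s \<in> ip_Cauchy ip" "f = fn (cls s)"
      using f by (rule fn_image_cases)
    show ?thesis
      using tendsto_rabs[OF fn_cls_tendsto[OF s(1) t]] tendsto_mult_left[OF fip_norm_tendsto[OF s(1)]]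
      unfolding s(2) by (rule LIMSEQ_le) (simp add: ev_bound[OF t])
  qed
  then show "\<exists>C. \<forall>f\<in>fn ` X. \<bar>f t\<bar> \<le> C * ip_norm fip f"
    by blast
  fix f assume "f \<in> fn ` X"
  then obtain s where s: "s \<in> ip_Cauchy ip" "f = fn (cls s)"
    by (rule fn_image_cases)
  show "f t = fip f (\<lambda>s\<in>T. ev (kp t) s)"
    using fn_cls_tendsto[OF s(1) t] fip_tendsto[OF s(1) Cauchy_const[of "kp t"]]
    unfolding k s(2) by (intro LIMSEQ_unique) (simp_all add: reproducing[OF t])
qed

end

section \<open>The reproducing kernel\<close>

interpretation diff: semi_inner diff_inner
  by unfold_locales
    (rule diff_inner_commute diff_inner_add_left diff_inner_scaleR_left diff_inner_self_nonneg)+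

lemma diff_inner_of_disc: "diff_inner x (of_body unit_disc) = mixed x (of_body unit_disc) / (2 * pi)"
  by (simp add: diff_inner_eq mixed_disc_disc field_simps power2_eq_square)

text \<open>The formula for the inner product is solved for \<open>mixed\<close>. Pairing with the
  disc, which has norm 1, bounds the perimeters; they contribute
  \<open>(2 * pi)^2 / pi = 4 * pi\<close> to the constant and the inner product contributes
  \<open>2 * pi\<close>.\<close>

lemma abs_mixed_le: "\<bar>mixed x y\<bar> \<le> 6 * pi * (ip_norm diff_inner x * ip_norm diff_inner y)"
proof -
  let ?D = "of_body unit_disc" and ?n = "ip_norm diff_inner"
  have "?n ?D = 1"
    by (simp add: ip_norm_def diff_inner_of_disc mixed_disc_disc)
  then have disc: "\<bar>mixed z ?D\<bar> \<le> 2 * pi * ?n z" for z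
    using diff.cauchy_schwarz[of z ?D] by (simp add: diff_inner_of_disc field_simps)
  have "mixed x y = (mixed x ?D * mixed y ?D) / pi - 2 * pi * diff_inner x y"
    by (simp add: diff_inner_eq field_simps power2_eq_square)
  also have "\<bar>\<dots>\<bar> \<le> \<bar>mixed x ?D\<bar> * \<bar>mixed y ?D\<bar> / pi + 2 * pi * \<bar>diff_inner x y\<bar>"
    using abs_triangle_ineq4[of "(mixed x ?D * mixed y ?D) / pi" "2 * pi * diff_inner x y"]
    by (simp add: abs_mult)
  also have "\<dots> \<le> (2 * pi * ?n x) * (2 * pi * ?n y) / pi + 2 * pi * (?n x * ?n y)"
    using disc[of x] disc[of y] diff.cauchy_schwarz[of x y] diff.nrm_nonneg
    by (intro add_mono divide_right_mono mult_mono mult_left_mono) auto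
  finally show ?thesis
    by (simp add: field_simps)
qed

text \<open>The squared norm is a polynomial in areas of sums with the zonotope, all of which
  converge. In the limit the self term vanishes because
  \<open>area (P + P) = 4 * area P\<close>.\<close>

lemma zonotope_tendsto_nrm:
  "(\<lambda>k. ip_norm diff_inner (of_body P - of_body (zonotope (2 * Suc k) P))) \<longlonglongrightarrow> 0"
proof -
  let ?Z = "\<lambda>k. zonotope (2 * Suc k) P" and ?D = "of_body unit_disc"
  have Z: "(\<lambda>k. area (V + ?Z k)) \<longlonglongrightarrow> area (V + P)" for V
    by (rule area_zonotope_tendsto)
  have Z0: "(\<lambda>k. area (?Z k)) \<longlonglongrightarrow> area P"
    using Z[of 0] by simp
  have "mixed (of_body P - of_body (?Z k)) ?D
      = (area (unit_disc + P) - area P) - (area (unit_disc + ?Z k) - area (?Z k))" for k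
    by (simp add: mixed_diff_left mixed_of_body add.commute)
  moreover have "(\<lambda>k. (area (unit_disc + P) - area P) - (area (unit_disc + ?Z k) - area (?Z k)))
      \<longlonglongrightarrow> (area (unit_disc + P) - area P) - (area (unit_disc + P) - area P)"
    by (intro tendsto_intros Z Z0)
  ultimately have 1: "(\<lambda>k. mixed (of_body P - of_body (?Z k)) ?D) \<longlonglongrightarrow> 0"
    by simp
  have "mixed (of_body P - of_body (?Z k)) (of_body P - of_body (?Z k))
      = 2 * area P + 2 * area (?Z k) - 2 * (area (P + ?Z k) - area P - area (?Z k))" for k
    using mixed_commute[of "of_body (?Z k)" "of_body P"] mixed_of_body[of P "?Z k"]
    by (simp add: mixed_diff_left mixed_diff_right mixed_self_of_body)
  moreover have "(\<lambda>k. 2 * area P + 2 * area (?Z k) - 2 * (area (P + ?Z k) - area P - area (?Z k)))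
      \<longlonglongrightarrow> 2 * area P + 2 * area P - 2 * (area (P + P) - area P - area P)"
    by (intro tendsto_intros Z Z0)
  ultimately have 2: "(\<lambda>k. mixed (of_body P - of_body (?Z k)) (of_body P - of_body (?Z k))) \<longlonglongrightarrow> 0"
    using mixed_self_of_body[of P] mixed_of_body[of P P] by simp
  have "(\<lambda>k. sqrt (1 / (4 * pi\<^sup>2) *
      (2 * mixed (of_body P - of_body (?Z k)) ?D * mixed (of_body P - of_body (?Z k)) ?D
      - 2 * pi * mixed (of_body P - of_body (?Z k)) (of_body P - of_body (?Z k)))))
      \<longlonglongrightarrow> sqrt (1 / (4 * pi\<^sup>2) * (2 * 0 * 0 - 2 * pi * 0))"
    by (intro tendsto_intros 1 2)
  then show ?thesis
    by (simp add: ip_norm_def diff_inner_eq)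
qed

text \<open>Pairing with a zonotope reads \<open>x\<close> at finitely many angles only; this is
  where pointwise convergence enters.\<close>

lemma mixed_zonotope:
  assumes "2 \<le> n"
  shows "mixed x (of_body (zonotope n P)) = grid_sum n (diff_eval x) (half_width P)"
proof -
  obtain U V where x: "x = body_class U V"
    using body_class_cases by metis
  have eval: "diff_eval x = (\<lambda>\<phi>. half_width U \<phi> + (- 1) * half_width V \<phi>)"
    by (simp add: fun_eq_iff x diff_eval_body_class)
  have "grid_sum n (diff_eval x) (half_width P)
      = grid_sum n (half_width U) (half_width P) - grid_sum n (half_width V) (half_width P)"
    unfolding eval grid_sum_add_left grid_sum_cmult_left by simp
  then show ?thesis
    by (simp add: x mixed_body_class area_plus_zonotope_grid[OF assms, symmetric])
qed

lemma grid_in_interval: "i < n \<Longrightarrow> real i * (pi / real n) \<in> {0..pi}"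
  by (auto simp: field_simps)

lemma mixed_tendsto_zero:
  assumes s: "s \<in> ip_Cauchy diff_inner" and ev: "\<And>\<phi>. \<phi> \<in> {0..pi} \<Longrightarrow> (\<lambda>n. diff_eval (s n) \<phi>) \<longlonglongrightarrow> 0"
  shows "(\<lambda>n. mixed (s n) y) \<longlonglongrightarrow> 0"
proof -
  have body: "(\<lambda>n. mixed (s n) (of_body P)) \<longlonglongrightarrow> 0" for P
  proof (rule LIMSEQ_I)
    fix e :: real assume e: "0 < e"
    have "Bseq (\<lambda>n. ip_norm diff_inner (s n))"
      using diff.nrm_convergent[OF s] by (rule convergent_imp_Bseq)
    then obtain C where C: "0 < C" "\<And>n. ip_norm diff_inner (s n) \<le> C"
      unfolding Bseq_def by (auto simp: diff.nrm_nonneg)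
    define z where "z = (\<lambda>k. zonotope (2 * Suc k) P)"
    \<comment> \<open>With norms bounded by \<open>C\<close>, the factor \<open>6 * pi\<close> of
      \<open>abs_mixed_le\<close> turns this into an error of \<open>e / 2\<close>, uniformly in
      \<open>n\<close>.\<close>
    have "0 < e / (12 * pi * C)"
      using e C(1) by simp
    then obtain k where k: "ip_norm diff_inner (of_body P - of_body (z k)) < e / (12 * pi * C)"
      using LIMSEQ_D[OF zonotope_tendsto_nrm[of P]] unfolding z_def
      by (metis order_refl diff_zero real_norm_def abs_of_nonneg diff.nrm_nonneg)
    have "(\<lambda>n. grid_sum (2 * Suc k) (diff_eval (s n)) (half_width P)) \<longlonglongrightarrow> 0"
      unfolding grid_sum_def
      by (intro tendsto_mult_right_zero tendsto_null_sum ev grid_in_interval) simp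
    then obtain N where N: "\<And>n. N \<le> n \<Longrightarrow> \<bar>grid_sum (2 * Suc k) (diff_eval (s n)) (half_width P)\<bar> < e / 2"
      using LIMSEQ_D[of _ 0 "e / 2"] e by (metis diff_zero half_gt_zero real_norm_def)
    have "norm (mixed (s n) (of_body P) - 0) < e" if "N \<le> n" for n
    proof -
      have "\<bar>mixed (s n) (of_body P - of_body (z k))\<bar>
          \<le> 6 * pi * (ip_norm diff_inner (s n) * ip_norm diff_inner (of_body P - of_body (z k)))"
        by (rule abs_mixed_le)
      also have "\<dots> \<le> 6 * pi * (C * (e / (12 * pi * C)))"
        using C k e diff.nrm_nonneg by (intro mult_left_mono mult_mono) auto
      also have "\<dots> = e / 2"
        using C(1) by simp
      finally have "\<bar>mixed (s n) (of_body P - of_body (z k))\<bar> \<le> e / 2" .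
      moreover have "mixed (s n) (of_body P)
          = mixed (s n) (of_body P - of_body (z k)) + grid_sum (2 * Suc k) (diff_eval (s n)) (half_width P)"
        by (simp add: mixed_diff_right mixed_zonotope[symmetric] z_def)
      ultimately show ?thesis
        using N[OF that] by simp
    qed
    then show "\<exists>N. \<forall>n\<ge>N. norm (mixed (s n) (of_body P) - 0) < e"
      by blast
  qed
  obtain P Q where "y = body_class P Q"
    using body_class_cases by metis
  then have "y = of_body P - of_body Q"
    by (simp add: minus_body_diff_def uminus_body_class plus_body_class)
  then show ?thesis
    using tendsto_diff[OF body[of P] body[of Q]] by (simp add: mixed_diff_right)
qed

text \<open>The squared norm of \<open>s n\<close> splits into its pairings with \<open>s N\<close>
  and with \<open>s n - s N\<close>. For fixed \<open>N\<close> the first tends to 0 by weak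
  convergence, and the second is at most \<open>e\<close> times the norm. So the limit
  \<open>a\<close> of the norms satisfies \<open>a^2 \<le> a * e\<close> for every positive
  \<open>e\<close> below \<open>a\<close>, which is impossible if \<open>a\<close> is
  positive.\<close>

lemma diff_nrm_tendsto_zero:
  assumes s: "s \<in> ip_Cauchy diff_inner" and ev: "\<And>\<phi>. \<phi> \<in> {0..pi} \<Longrightarrow> (\<lambda>n. diff_eval (s n) \<phi>) \<longlonglongrightarrow> 0"
  shows "(\<lambda>n. ip_norm diff_inner (s n)) \<longlonglongrightarrow> 0"
proof -
  let ?n = "ip_norm diff_inner"
  have weak: "(\<lambda>n. diff_inner (s n) y) \<longlonglongrightarrow> 0" for y
  proof -
    have "(\<lambda>n. 1 / (4 * pi\<^sup>2) * (2 * mixed (s n) (of_body unit_disc) * mixed y (of_body unit_disc)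
        - 2 * pi * mixed (s n) y)) \<longlonglongrightarrow> 1 / (4 * pi\<^sup>2) * (2 * 0 * mixed y (of_body unit_disc) - 2 * pi * 0)"
      by (intro tendsto_intros mixed_tendsto_zero[OF s ev])
    then show ?thesis
      by (simp add: diff_inner_eq)
  qed
  obtain a where a: "(\<lambda>n. ?n (s n)) \<longlonglongrightarrow> a"
    using diff.nrm_convergent[OF s] unfolding convergent_def by blast
  have a0: "0 \<le> a"
    using a by (rule LIMSEQ_le_const) (simp add: diff.nrm_nonneg)
  have "a \<le> 0 + e" if e: "0 < e" for e
  proof (rule ccontr)
    assume "\<not> a \<le> 0 + e"
    then have ae: "e < a"
      by simp
    obtain N where N: "\<And>m n. N \<le> m \<Longrightarrow> N \<le> n \<Longrightarrow> ?n (s m - s n) < e"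
      using s e unfolding ip_Cauchy_def by blast
    have lim1: "(\<lambda>n. (?n (s n))\<^sup>2) \<longlonglongrightarrow> a\<^sup>2"
      by (intro tendsto_intros a)
    have lim2: "(\<lambda>n. diff_inner (s n) (s N) + ?n (s n) * e) \<longlonglongrightarrow> 0 + a * e"
      by (intro tendsto_intros a weak)
    have "(?n (s n))\<^sup>2 \<le> diff_inner (s n) (s N) + ?n (s n) * e" if "N \<le> n" for n
    proof -
      have "(?n (s n))\<^sup>2 = diff_inner (s n) (s N) + diff_inner (s n) (s n - s N)"
        by (simp add: diff.nrm_power2 diff.diff_right)
      also have "diff_inner (s n) (s n - s N) \<le> ?n (s n) * ?n (s n - s N)"
        using diff.cauchy_schwarz[of "s n" "s n - s N"] by linarith
      also have "\<dots> \<le> ?n (s n) * e"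
        using N[OF that order_refl] by (intro mult_left_mono) (auto simp: diff.nrm_nonneg)
      finally show ?thesis
        by simp
    qed
    then have "a\<^sup>2 \<le> 0 + a * e"
      by (intro LIMSEQ_le[OF lim1 lim2]) blast
    with ae e show False
      by (simp add: power2_eq_square)
  qed
  then have "a \<le> 0"
    by (rule field_le_epsilon)
  with a a0 show ?thesis
    by simp
qed

interpretation diff: kernel_space diff_inner diff_eval kernel_point "{0..pi}"
  by unfold_locales (auto intro: diff_inner_kernel_point diff_nrm_tendsto_zero)

lemma diff_function_eq: "diff_function = diff.fn"
  by (simp add: fun_eq_iff diff_function_def diff.fn_def)

lemma transported_inner_eq: "transported_inner = diff.fip"
  by (simp add: fun_eq_iff transported_inner_def diff.fip_def diff_function_eq)

lemma sin_abs_eq: "\<phi> \<in> {0..pi} \<Longrightarrow> \<psi> \<in> {0..pi} \<Longrightarrow> \<bar>sin (\<phi> - \<psi>)\<bar> = sin \<bar>\<phi> - \<psi>\<bar>"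
  using sin_ge_zero[of "\<bar>\<phi> - \<psi>\<bar>"] sin_minus[of "\<phi> - \<psi>"] by (cases "\<psi> \<le> \<phi>") auto

lemma rkhs_cong_kernel:
  assumes "rkhs T H ip K" "\<And>s t. s \<in> T \<Longrightarrow> t \<in> T \<Longrightarrow> K s t = K' s t"
  shows "rkhs T H ip K'"
proof -
  have "(\<lambda>s\<in>T. K' s t) = (\<lambda>s\<in>T. K s t)" if "t \<in> T" for t
    using assms(2)[OF _ that] by (intro restrict_ext) simp
  with assms(1) show ?thesis
    by (simp add: rkhs_def)
qed

theorem theorem29:
  shows
    "(\<forall>\<phi>\<in>{0..pi}. \<exists>C. \<forall>x. \<bar>diff_eval x \<phi>\<bar> \<le> C * ip_norm diff_inner x)
   \<and> (\<forall>x. diff_function (completion_embed diff_inner x) = (\<lambda>\<phi>\<in>{0..pi}. diff_eval x \<phi>))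
   \<and> (\<forall>A\<in>diff_completion. \<forall>s\<in>A. \<forall>\<phi>\<in>{0..pi}.
        (\<lambda>n. diff_eval (s n) \<phi>) \<longlonglongrightarrow> diff_function A \<phi>)
   \<and> (\<forall>A\<in>diff_completion. \<forall>B\<in>diff_completion.
        diff_function (completion_add diff_inner A B)
          = (\<lambda>\<phi>\<in>{0..pi}. diff_function A \<phi> + diff_function B \<phi>))
   \<and> (\<forall>c. \<forall>A\<in>diff_completion.
        diff_function (completion_scale diff_inner c A)
          = (\<lambda>\<phi>\<in>{0..pi}. c * diff_function A \<phi>))
   \<and> inj_on diff_function diff_completion
   \<and> rkhs {0..pi} (diff_function ` diff_completion) transported_inner
        (\<lambda>\<phi> \<psi>. 2 - pi / 2 * sin \<bar>\<phi> - \<psi>\<bar>)"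
proof -
  have "rkhs {0..pi} (diff_function ` diff_completion) transported_inner
      (\<lambda>\<phi> \<psi>. 2 - pi / 2 * sin \<bar>\<phi> - \<psi>\<bar>)"
    unfolding diff_function_eq transported_inner_eq
    by (rule rkhs_cong_kernel[OF diff.rkhs_fn]) (simp add: diff_eval_kernel_point sin_abs_eq)
  then show ?thesis
    using diff.ev_bound diff.fn_embed diff.fn_tendsto diff.fn_add diff.fn_scale diff.inj_on_fn
    unfolding diff_function_eq by blast
qed

end
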